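(* Let $\mathcal{E}$ be a separable Hilbert space, let $k:\mathbb{D}\times\mathbb{D}\to\mathbb{C}$ be a scalar-valued analytic kernel, let $K(z,w)=k(z,w)I_{\mathcal{E}}$ for $z,w\in\mathbb{D}$, and let $\mathcal{H}_{\mathcal{E}}(K)$ be the corresponding (quasi-scalar) reproducing kernel Hilbert space. Suppose that the multiplication operator $M_z$ on $\mathcal{H}_{\mathcal{E}}(K)$ is bounded. Then: (1) $M_z^*$ is hypercyclic if $$\liminf_{n}\frac{1}{(n!)^2}\frac{\partial^{2n}k}{\partial z^n\partial\bar{w}^n}(0,0)=0.$$ (2) $M_z^*$ is topologically mixing if $$\lim_{n}\frac{1}{(n!)^2}\frac{\partial^{2n}k}{\partial z^n\partial\bar{w}^n}(0,0)=0.$$ (3) $M_z^*$ is chaotic if the double series $$\sum_{n,m\ge 0}\frac{1}{n!\,m!}\frac{\partial^{n+m}k}{\partial z^n\partial\bar{w}^m}(0,0)$$ is $\mathcal{F}$-summable.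
   Context: $\mathbb{D}$ is the open unit disc in $\mathbb{C}$; inner products are linear in the first variable. For a Hilbert space $\mathcal{E}$, a function $K:\mathbb{D}\times\mathbb{D}\to\mathcal{B}(\mathcal{E})$ is an analytic kernel if $K$ is analytic in the first variable and $\sum_{i,j=1}^n\langle K(z_i,z_j)\eta_j,\eta_i\rangle_{\mathcal{E}}\ge 0$ for all $n\in\mathbb{N}$, $z_1,\dots,z_n\in\mathbb{D}$, $\eta_1,\dots,\eta_n\in\mathcal{E}$; a scalar-valued analytic kernel is the case $\mathcal{E}=\mathbb{C}$. (Then $K(z,w)^*=K(w,z)$, so $K$ is co-analytic in $w$ and derivatives in $\bar w$ make sense.) The corresponding analytic reproducing kernel Hilbert space $\mathcal{H}_{\mathcal{E}}(K)$ is the Hilbert space of $\mathcal{E}$-valued analytic functions on $\mathbb{D}$ in which $\{K(\cdot,w)\eta: w\in\mathbb{D},\eta\in\mathcal{E}\}$ is total and $\langle f,K(\cdot,w)\eta\rangle_{\mathcal{H}_{\mathcal{E}}(K)}=\langle f(w),\eta\rangle_{\mathcal{E}}$ for all $f\in\mathcal{H}_{\mathcal{E}}(K)$, $w\in\mathbb{D}$, $\eta\in\mathcal{E}$. $M_z$ is the operator $(M_zf)(w)=wf(w)$; "$M_z$ is bounded" means it maps the space into itself as a bounded operator, and $M_z^*$ is its adjoint. A double series $\sum_{i,j\ge 0}u_{i,j}$ in a Hilbert space (here, in $\mathbb{C}$) is $\mathcal{F}$-summable if for every $\epsilon>0$ there exists $N\in\mathbb{N}$ such that $\|\sum_{i,j\in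 F}u_{i,j}\|<\epsilon$ for all finite sets $F\subset\{N,N+1,\dots\}$ (the sum is over all pairs $(i,j)\in F\times F$). A bounded linear operator $T$ on a Banach space $X$ is hypercyclic if there is $x\in X$ with $\{x,Tx,T^2x,\dots\}$ dense in $X$; topologically mixing if for any two non-empty open sets $U,V\subseteq X$ there is $N\in\mathbb{N}$ with $T^{-j}(U)\cap V\neq\emptyset$ for all $j\ge N$; chaotic if it is hypercyclic and has a dense set of periodic points ($y$ is periodic for $T$ if $T^ky=y$ for some integer $k\ge 1$). *)

theory Defs
  imports "HOL-Complex_Analysis.Complex_Analysis"
begin

section \<open>Complex Hilbert spaces\<close>

text \<open>
  The distribution only has real inner product spaces. The inner product below is linear in the
  first variable; the norm (and with it the topology) is the one of \<^class>\<open>real_normed_vector\<close>.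
\<close>

class complex_inner = real_normed_vector +
  fixes scaleC :: "complex \<Rightarrow> 'a \<Rightarrow> 'a" (infixr "*\<^sub>C" 75)
    and cinner :: "'a \<Rightarrow> 'a \<Rightarrow> complex"
  assumes scaleC_add_right: "a *\<^sub>C (x + y) = a *\<^sub>C x + a *\<^sub>C y"
    and scaleC_add_left: "(a + b) *\<^sub>C x = a *\<^sub>C x + b *\<^sub>C x"
    and scaleC_scaleC: "a *\<^sub>C b *\<^sub>C x = (a * b) *\<^sub>C x"
    and scaleC_of_real: "complex_of_real r *\<^sub>C x = r *\<^sub>R x"
    and cinner_commute: "cinner y x = cnj (cinner x y)"
    and cinner_add_left: "cinner (x + y) z = cinner x z + cinner y z"
    and cinner_scaleC_left: "cinner (a *\<^sub>C x) y = a * cinner x y"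
    and cinner_self: "cinner x x = complex_of_real ((norm x)\<^sup>2)"

class chilbert_space = complex_inner + complete_space

instantiation complex :: chilbert_space
begin

definition "a *\<^sub>C (z::complex) = a * z"
definition "cinner z w = z * cnj (w::complex)"

instance
  by standard
     (simp_all add: scaleC_complex_def cinner_complex_def algebra_simps scaleR_conv_of_real
        flip: complex_norm_square)

end

section \<open>Hilbert spaces of functions\<close>

text \<open>
  The elements are functions on the open unit disc, represented by functions on all of
  \<^typ>\<open>complex\<close> that vanish outside the disc; so equality of elements is equality on the disc.
\<close>

abbreviation unit_disc :: "complex set" where
  "unit_disc \<equiv> ball 0 1"

definition hnorm :: "((complex \<Rightarrow> 'e) \<Rightarrow> (complex \<Rightarrow> 'e) \<Rightarrow> complex) \<Rightarrow> (complex \<Rightarrow> 'e) \<Rightarrow> real" where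
  "hnorm ip f = sqrt (Re (ip f f))"

text \<open>The value off \<open>H\<close> is irrelevant; it is set to 0 because \<^locale>\<open>Metric_space\<close> requires
  nonnegativity and symmetry for all arguments.\<close>

definition hdist ::
  "(complex \<Rightarrow> 'e::complex_inner) set \<Rightarrow> ((complex \<Rightarrow> 'e) \<Rightarrow> (complex \<Rightarrow> 'e) \<Rightarrow> complex)
    \<Rightarrow> (complex \<Rightarrow> 'e) \<Rightarrow> (complex \<Rightarrow> 'e) \<Rightarrow> real" where
  "hdist H ip f g = (if f \<in> H \<and> g \<in> H then hnorm ip (\<lambda>z. f z - g z) else 0)"

abbreviation htopology ::
  "(complex \<Rightarrow> 'e::complex_inner) set \<Rightarrow> ((complex \<Rightarrow> 'e) \<Rightarrow> (complex \<Rightarrow> 'e) \<Rightarrow> complex)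
    \<Rightarrow> (complex \<Rightarrow> 'e) topology" where
  "htopology H ip \<equiv> Metric_space.mtopology H (hdist H ip)"

locale function_inner_space =
  fixes H :: "(complex \<Rightarrow> 'e::complex_inner) set"
    and ip :: "(complex \<Rightarrow> 'e) \<Rightarrow> (complex \<Rightarrow> 'e) \<Rightarrow> complex"
  assumes zero_off_disc: "\<lbrakk>f \<in> H; z \<notin> unit_disc\<rbrakk> \<Longrightarrow> f z = 0"
    and zero_mem: "(\<lambda>z. 0) \<in> H"
    and add_mem: "\<lbrakk>f \<in> H; g \<in> H\<rbrakk> \<Longrightarrow> (\<lambda>z. f z + g z) \<in> H"
    and scale_mem: "f \<in> H \<Longrightarrow> (\<lambda>z. c *\<^sub>C f z) \<in> H"
    and ip_commute: "\<lbrakk>f \<in> H; g \<in> H\<rbrakk> \<Longrightarrow> ip g f = cnj (ip f g)"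
    and ip_add_left: "\<lbrakk>f \<in> H; g \<in> H; h \<in> H\<rbrakk> \<Longrightarrow> ip (\<lambda>z. f z + g z) h = ip f h + ip g h"
    and ip_scale_left: "\<lbrakk>f \<in> H; g \<in> H\<rbrakk> \<Longrightarrow> ip (\<lambda>z. c *\<^sub>C f z) g = c * ip f g"
    and ip_nonneg: "f \<in> H \<Longrightarrow> ip f f \<in> \<real>\<^sub>\<ge>\<^sub>0"
    and ip_definite: "\<lbrakk>f \<in> H; ip f f = 0\<rbrakk> \<Longrightarrow> f = (\<lambda>z. 0)"

lemma scaleC_minus_one: "(-1) *\<^sub>C (x::'a::complex_inner) = - x"
  using scaleC_of_real[of "-1" x] by simp

context function_inner_space
begin

lemma uminus_mem: "f \<in> H \<Longrightarrow> (\<lambda>z. - f z) \<in> H"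
  using scale_mem[of f "-1"] by (simp add: scaleC_minus_one)

lemma diff_mem: "\<lbrakk>f \<in> H; g \<in> H\<rbrakk> \<Longrightarrow> (\<lambda>z. f z - g z) \<in> H"
  using add_mem[OF _ uminus_mem, of f g] by simp

lemma ip_self: "f \<in> H \<Longrightarrow> 0 \<le> Re (ip f f) \<and> Im (ip f f) = 0"
  using ip_nonneg[of f] by (auto simp: complex_nonneg_Reals_iff)

lemma ip_zero_left: "g \<in> H \<Longrightarrow> ip (\<lambda>z. 0) g = 0"
  using ip_scale_left[OF zero_mem, of g 0] scaleC_of_real[of 0 "0::'e"] by simp

lemma Re_ip_add_self:
  assumes "f \<in> H" "g \<in> H"
  shows "Re (ip (\<lambda>z. f z + g z) (\<lambda>z. f z + g z)) = Re (ip f f) + 2 * Re (ip f g) + Re (ip g g)"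
proof -
  have s: "(\<lambda>z. f z + g z) \<in> H" using assms by (rule add_mem)
  have 1: "ip f (\<lambda>z. f z + g z) = cnj (ip f f + ip g f)"
    using ip_commute[OF s assms(1)] ip_add_left assms by simp
  have 2: "ip g (\<lambda>z. f z + g z) = cnj (ip f g + ip g g)"
    using ip_commute[OF s assms(2)] ip_add_left assms by simp
  have 3: "Re (ip g f) = Re (ip f g)"
    using ip_commute[OF assms] by simp
  show ?thesis
    using ip_add_left[OF assms s] 1 2 3 by simp
qed

lemma Re_ip_scale_self:
  assumes "f \<in> H"
  shows "Re (ip (\<lambda>z. of_real t *\<^sub>C f z) (\<lambda>z. of_real t *\<^sub>C f z)) = t\<^sup>2 * Re (ip f f)"
proof -
  have s: "(\<lambda>z. of_real t *\<^sub>C f z) \<in> H" using assms by (rule scale_mem)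
  have "ip f (\<lambda>z. of_real t *\<^sub>C f z) = cnj (of_real t * ip f f)"
    using ip_commute[OF s assms] ip_scale_left[OF assms assms] by simp
  then show ?thesis
    using ip_scale_left[OF assms s, of "of_real t"] by (simp add: power2_eq_square)
qed

lemma Cauchy_Schwarz_Re:
  assumes "f \<in> H" "g \<in> H"
  shows "Re (ip f g) \<le> hnorm ip f * hnorm ip g"
proof (cases "Re (ip g g) = 0")
  case True
  then have "g = (\<lambda>z. 0)"
    using ip_definite[OF assms(2)] ip_self[OF assms(2)] by (simp add: complex_eq_iff)
  then have "ip g f = 0" using ip_zero_left[OF assms(1)] by simp
  then show ?thesis
    using ip_commute[OF assms(2,1)] ip_self assms by (simp add: hnorm_def)
next
  case False
  define a b c where "a = Re (ip f f)" and "b = Re (ip f g)" and "c = Re (ip g g)"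
  have c: "c > 0" using False ip_self[OF assms(2)] by (simp add: c_def)
  define t where "t = - b / c"
  let ?g = "\<lambda>z. of_real t *\<^sub>C g z"
  have g: "?g \<in> H" using assms(2) by (rule scale_mem)
  have "ip f ?g = cnj (of_real t * ip g f)"
    using ip_commute[OF g assms(1)] ip_scale_left[OF assms(2,1)] by simp
  then have "Re (ip f ?g) = t * b"
    using ip_commute[OF assms] by (simp add: b_def)
  then have "0 \<le> a + 2 * (t * b) + t\<^sup>2 * c"
    using ip_self[OF add_mem[OF assms(1) g]] Re_ip_add_self[OF assms(1) g]
      Re_ip_scale_self[OF assms(2), of t] by (simp add: a_def c_def)
  also have "\<dots> = a - b\<^sup>2 / c"
    using c by (simp add: t_def power2_eq_square field_simps)
  finally have "b\<^sup>2 \<le> a * c" using c by (simp add: field_simps)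
  then have "b \<le> sqrt (a * c)" by (rule real_le_rsqrt)
  then show ?thesis by (simp add: a_def b_def c_def hnorm_def real_sqrt_mult)
qed

lemma hnorm_triangle:
  assumes "f \<in> H" "g \<in> H"
  shows "hnorm ip (\<lambda>z. f z + g z) \<le> hnorm ip f + hnorm ip g"
  unfolding hnorm_def[of ip "\<lambda>z. f z + g z"]
proof (rule real_le_lsqrt)
  show "0 \<le> hnorm ip f + hnorm ip g" using ip_self assms by (simp add: hnorm_def)
  show "Re (ip (\<lambda>z. f z + g z) (\<lambda>z. f z + g z)) \<le> (hnorm ip f + hnorm ip g)\<^sup>2"
    using Re_ip_add_self[OF assms] Cauchy_Schwarz_Re[OF assms] ip_self assms
    by (simp add: power2_sum) (simp add: hnorm_def)
qed

end

sublocale function_inner_space \<subseteq> Metric_space H "hdist H ip"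
proof
  show "0 \<le> hdist H ip f g" for f g
    using ip_self[OF diff_mem, of f g] by (simp add: hdist_def hnorm_def)
  have *: "hnorm ip (\<lambda>z. f z - g z) = hnorm ip (\<lambda>z. g z - f z)" if "f \<in> H" "g \<in> H" for f g
    using Re_ip_scale_self[OF diff_mem[OF that], of "-1"]
    by (simp add: hnorm_def scaleC_minus_one)
  then show "hdist H ip f g = hdist H ip g f" for f g
    by (auto simp: hdist_def)
  show "hdist H ip f g = 0 \<longleftrightarrow> f = g" if "f \<in> H" "g \<in> H" for f g
  proof
    assume "hdist H ip f g = 0"
    then have "ip (\<lambda>z. f z - g z) (\<lambda>z. f z - g z) = 0"
      using ip_self[OF diff_mem[OF that]] that by (simp add: hdist_def hnorm_def complex_eq_iff)
    then show "f = g"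
      using ip_definite[OF diff_mem[OF that]] by (auto simp: fun_eq_iff)
  qed (use ip_zero_left[OF zero_mem] in \<open>simp add: hdist_def hnorm_def\<close>)
  show "hdist H ip f h \<le> hdist H ip f g + hdist H ip g h" if "f \<in> H" "g \<in> H" "h \<in> H" for f g h
    using hnorm_triangle[OF diff_mem[OF that(1,2)] diff_mem[OF that(2,3)]] that
    by (simp add: hdist_def)
qed

locale function_hilbert_space = function_inner_space H ip
  for H :: "(complex \<Rightarrow> 'e::complex_inner) set" and ip +
  assumes complete: "Metric_space.mcomplete H (hdist H ip)"

section \<open>Kernels and reproducing kernel Hilbert spaces\<close>

text \<open>Scalar kernels; the quadratic form is \<open>\<langle>k (z i) (z j) \<eta>\<^sub>j, \<eta>\<^sub>i\<rangle>\<close> summed over \<open>i, j\<close>.\<close>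

definition analytic_kernel :: "(complex \<Rightarrow> complex \<Rightarrow> complex) \<Rightarrow> bool" where
  "analytic_kernel k \<longleftrightarrow>
     (\<forall>w\<in>unit_disc. (\<lambda>z. k z w) holomorphic_on unit_disc) \<and>
     (\<forall>(n::nat) z \<eta>. (\<forall>i<n. z i \<in> unit_disc) \<longrightarrow>
        (\<Sum>i<n. \<Sum>j<n. cinner (k (z i) (z j) * \<eta> j) (\<eta> i)) \<in> \<real>\<^sub>\<ge>\<^sub>0)"

definition analytic_on_disc :: "(complex \<Rightarrow> 'e::complex_inner) \<Rightarrow> bool" where
  "analytic_on_disc f \<longleftrightarrow>
     (\<forall>z\<in>unit_disc. \<exists>f'. (f has_derivative (\<lambda>h. h *\<^sub>C f')) (at z))"

definition kernel_fun ::
  "(complex \<Rightarrow> complex \<Rightarrow> 'e \<Rightarrow> 'e) \<Rightarrow> complex \<Rightarrow> 'e \<Rightarrow> complex \<Rightarrow> 'e::complex_inner" where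
  "kernel_fun K w \<eta> = (\<lambda>z. if z \<in> unit_disc then K z w \<eta> else 0)"

definition cspan_fun :: "(complex \<Rightarrow> 'e::complex_inner) set \<Rightarrow> (complex \<Rightarrow> 'e) set" where
  "cspan_fun S = {(\<lambda>z. \<Sum>i<n. c i *\<^sub>C g i z) | (n::nat) c g. \<forall>i<n. g i \<in> S}"

locale analytic_rkhs = function_hilbert_space H ip
  for K :: "complex \<Rightarrow> complex \<Rightarrow> 'e::chilbert_space \<Rightarrow> 'e"
    and H :: "(complex \<Rightarrow> 'e) set" and ip +
  assumes analytic: "f \<in> H \<Longrightarrow> analytic_on_disc f"
    and kernel_mem: "w \<in> unit_disc \<Longrightarrow> kernel_fun K w \<eta> \<in> H"
    and total: "htopology H ip closure_of
                  cspan_fun {kernel_fun K w \<eta> | w \<eta>. w \<in> unit_disc} = H"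
    and reproducing: "\<lbrakk>f \<in> H; w \<in> unit_disc\<rbrakk> \<Longrightarrow> ip f (kernel_fun K w \<eta>) = cinner (f w) \<eta>"

definition quasi_scalar ::
  "(complex \<Rightarrow> complex \<Rightarrow> complex) \<Rightarrow> complex \<Rightarrow> complex \<Rightarrow> 'e \<Rightarrow> 'e::complex_inner" where
  "quasi_scalar k z w \<eta> = k z w *\<^sub>C \<eta>"

section \<open>Operators\<close>

definition bounded_operator ::
  "(complex \<Rightarrow> 'e::complex_inner) set \<Rightarrow> ((complex \<Rightarrow> 'e) \<Rightarrow> (complex \<Rightarrow> 'e) \<Rightarrow> complex)
    \<Rightarrow> ((complex \<Rightarrow> 'e) \<Rightarrow> (complex \<Rightarrow> 'e)) \<Rightarrow> bool" where
  "bounded_operator H ip T \<longleftrightarrow>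
     (\<forall>f\<in>H. T f \<in> H) \<and>
     (\<forall>f\<in>H. \<forall>g\<in>H. T (\<lambda>z. f z + g z) = (\<lambda>z. T f z + T g z)) \<and>
     (\<forall>c. \<forall>f\<in>H. T (\<lambda>z. c *\<^sub>C f z) = (\<lambda>z. c *\<^sub>C T f z)) \<and>
     (\<exists>C. \<forall>f\<in>H. hnorm ip (T f) \<le> C * hnorm ip f)"

text \<open>The adjoint is determined on \<open>H\<close> only; its values elsewhere are arbitrary.\<close>

definition hadjoint ::
  "(complex \<Rightarrow> 'e) set \<Rightarrow> ((complex \<Rightarrow> 'e) \<Rightarrow> (complex \<Rightarrow> 'e) \<Rightarrow> complex)
    \<Rightarrow> ((complex \<Rightarrow> 'e) \<Rightarrow> (complex \<Rightarrow> 'e)) \<Rightarrow> (complex \<Rightarrow> 'e) \<Rightarrow> (complex \<Rightarrow> 'e)" where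
  "hadjoint H ip T =
     (SOME S. (\<forall>g\<in>H. S g \<in> H) \<and> (\<forall>f\<in>H. \<forall>g\<in>H. ip (T f) g = ip f (S g)))"

definition mult_z :: "(complex \<Rightarrow> 'e::complex_inner) \<Rightarrow> complex \<Rightarrow> 'e" where
  "mult_z f = (\<lambda>w. w *\<^sub>C f w)"

section \<open>Linear dynamics\<close>

text \<open>These are properties of a self-map of the underlying set of a topological space.\<close>

definition hypercyclic :: "'a topology \<Rightarrow> ('a \<Rightarrow> 'a) \<Rightarrow> bool" where
  "hypercyclic X T \<longleftrightarrow>
     (\<exists>x\<in>topspace X. X closure_of {(T ^^ n) x | n. True} = topspace X)"

definition topologically_mixing :: "'a topology \<Rightarrow> ('a \<Rightarrow> 'a) \<Rightarrow> bool" where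
  "topologically_mixing X T \<longleftrightarrow>
     (\<forall>U V. openin X U \<and> U \<noteq> {} \<and> openin X V \<and> V \<noteq> {} \<longrightarrow>
        (\<exists>N. \<forall>j\<ge>N. ((T ^^ j) -` U) \<inter> V \<noteq> {}))"

definition chaotic :: "'a topology \<Rightarrow> ('a \<Rightarrow> 'a) \<Rightarrow> bool" where
  "chaotic X T \<longleftrightarrow> hypercyclic X T \<and>
     X closure_of {y \<in> topspace X. \<exists>k\<ge>1. (T ^^ k) y = y} = topspace X"

section \<open>Derivatives of the kernel and summability\<close>

text \<open>
  The derivative of a co-analytic \<open>f\<close> in the conjugate variable: the limit of
  \<open>(f (w + h) - f w) / cnj h\<close> for \<open>h\<close> tending to 0.
\<close>

definition deriv_conj :: "(complex \<Rightarrow> complex) \<Rightarrow> complex \<Rightarrow> complex" where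
  "deriv_conj f w = deriv (\<lambda>u. f (cnj u)) (cnj w)"

definition mixed_deriv ::
  "nat \<Rightarrow> nat \<Rightarrow> (complex \<Rightarrow> complex \<Rightarrow> complex) \<Rightarrow> complex \<Rightarrow> complex \<Rightarrow> complex" where
  "mixed_deriv n m k z w = (deriv ^^ n) (\<lambda>z'. (deriv_conj ^^ m) (k z') w) z"

definition F_summable :: "(nat \<Rightarrow> nat \<Rightarrow> 'a::real_normed_vector) \<Rightarrow> bool" where
  "F_summable u \<longleftrightarrow>
     (\<forall>\<epsilon>>0. \<exists>N. \<forall>F. finite F \<and> F \<subseteq> {N..} \<longrightarrow> norm (\<Sum>i\<in>F. \<Sum>j\<in>F. u i j) < \<epsilon>)"

end

theory Submission
  imports Defs
begin

text \<open>
  The functionals sending \<open>f\<close> to the pairing of its \<open>n\<close>-th Taylor coefficient at 0 with a vector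
  \<open>\<eta>\<close> are bounded (by the uniform boundedness principle, the evaluations on a smaller disc are
  equibounded), hence represented by some \<open>D n \<eta>\<close> in \<open>H\<close>. The adjoint \<open>T\<close> of \<open>M\<^sub>z\<close> acts as a
  backward shift, \<open>T (D (n + 1) \<eta>) = D n \<eta>\<close> and \<open>T (D 0 \<eta>) = 0\<close>; the finite sums of the \<open>D n \<eta>\<close> are
  dense; and \<open>\<langle>D m \<eta>, D n \<xi>\<rangle>\<close> is \<open>\<langle>\<eta>, \<xi>\<rangle>\<close> times the normalised mixed derivative of \<open>k\<close> at 0. If
  \<open>D (i + j) \<eta>\<close> is small then a small perturbation of a point annihilated by \<open>T ^^ j\<close> is carried to
  \<open>D i \<eta>\<close>: this gives mixing, and hypercyclicity through Birkhoff's transitivity theorem. If the double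
  series is \<open>F\<close>-summable then the sums of \<open>D (i + l * p) \<eta>\<close> over all \<open>l\<close> converge to points of period \<open>p\<close>
  that tend to \<open>D i \<eta>\<close> as \<open>p\<close> grows.
\<close>

section \<open>Inner products and Riesz representation\<close>

lemma scaleC_zero_left [simp]: "0 *\<^sub>C (x::'a::complex_inner) = 0"
  using scaleC_of_real[of 0 x] by simp

lemma scaleC_zero_right [simp]: "c *\<^sub>C (0::'a::complex_inner) = 0"
  using scaleC_add_right[of c 0 "0::'a"] by simp

lemma scaleC_diff_right: "c *\<^sub>C (x - y) = c *\<^sub>C x - c *\<^sub>C (y::'a::complex_inner)"
  using scaleC_add_right[of c "x - y" y] by (simp add: algebra_simps)

lemma scaleC_sum: "c *\<^sub>C (\<Sum>i\<in>A. g i) = (\<Sum>i\<in>A. c *\<^sub>C (g i :: 'a::complex_inner))"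
  by (induction A rule: infinite_finite_induct) (auto simp: scaleC_add_right)

lemma cinner_add_right: "cinner x (y + z) = cinner x y + cinner x (z::'a::complex_inner)"
  by (subst cinner_commute) (simp add: cinner_add_left flip: cinner_commute)

lemma cinner_scaleC_right: "cinner x (a *\<^sub>C y) = cnj a * cinner x (y::'a::complex_inner)"
  by (subst cinner_commute) (simp add: cinner_scaleC_left flip: cinner_commute)

lemma cinner_zero_left [simp]: "cinner 0 (y::'a::complex_inner) = 0"
  using cinner_scaleC_left[of 0 0 y] by simp

lemma cinner_minus_left: "cinner (- x) y = - cinner x (y::'a::complex_inner)"
  using cinner_scaleC_left[of "-1" x y] by (simp add: scaleC_minus_one)

lemma cinner_diff_left: "cinner (x - y) z = cinner x z - cinner y (z::'a::complex_inner)"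
  using cinner_add_left[of x "- y" z] by (simp add: cinner_minus_left)

lemma norm_scaleC: "norm (c *\<^sub>C (x::'a::complex_inner)) = cmod c * norm x"
proof -
  have "complex_of_real ((norm (c *\<^sub>C x))\<^sup>2) = c * cnj c * of_real ((norm x)\<^sup>2)"
    by (simp add: cinner_self[symmetric] cinner_scaleC_left cinner_scaleC_right del: of_real_power)
  also have "\<dots> = of_real ((cmod c * norm x)\<^sup>2)"
    by (simp add: complex_norm_square[symmetric] power_mult_distrib del: of_real_power)
  finally have "(norm (c *\<^sub>C x))\<^sup>2 = (cmod c * norm x)\<^sup>2"
    using of_real_eq_iff by blast
  then show ?thesis
    by (simp add: power2_eq_iff_nonneg)
qed

text \<open>The factor \<open>cnj (sgn x)\<close> rotates \<open>x\<close> onto the nonnegative real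
  axis. This upgrades bounds on real parts of inner products to bounds on moduli.\<close>

lemma cnj_sgn_mult_self: "cnj (sgn x) * x = of_real (cmod x)"
proof (cases "x = 0")
  case False
  have "cnj (sgn x) * x = (x * cnj x) / of_real (cmod x)" by (simp add: sgn_eq)
  also have "x * cnj x = of_real (cmod x) * of_real (cmod x)"
    by (simp add: complex_norm_square[symmetric] power2_eq_square)
  finally show ?thesis using False by simp
qed simp

text \<open>Cauchy-Schwarz is read off from the triangle inequality of the norm: expanding the
  square of \<open>norm (u + y)\<close> bounds the real part, and a rotation of \<open>x\<close>
  turns this into a bound on the modulus.\<close>

lemma norm_cinner_le: "cmod (cinner x y) \<le> norm x * norm (y::'a::complex_inner)"
proof -
  have R: "Re (cinner u y) \<le> norm u * norm y" for u :: 'a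
  proof -
    have "complex_of_real ((norm (u + y))\<^sup>2)
        = of_real ((norm u)\<^sup>2) + cinner u y + cnj (cinner u y) + of_real ((norm y)\<^sup>2)"
      using cinner_commute[of y u]
      by (simp add: cinner_self[symmetric] cinner_add_left cinner_add_right del: of_real_power)
    then have "(norm (u + y))\<^sup>2 = (norm u)\<^sup>2 + 2 * Re (cinner u y) + (norm y)\<^sup>2"
      by (simp add: complex_eq_iff)
    moreover have "(norm (u + y))\<^sup>2 \<le> (norm u + norm y)\<^sup>2"
      by (simp add: norm_triangle_ineq power_mono)
    ultimately show ?thesis by (simp add: power2_sum)
  qed
  show ?thesis
  proof (cases "cinner x y = 0")
    case False
    define c where "c = cnj (sgn (cinner x y))"
    have "c * cinner x y = of_real (cmod (cinner x y))"
      by (simp add: c_def cnj_sgn_mult_self)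
    then have "cmod (cinner x y) = Re (cinner (c *\<^sub>C x) y)" by (simp add: cinner_scaleC_left)
    also have "\<dots> \<le> norm (c *\<^sub>C x) * norm y" by (rule R)
    also have "\<dots> = norm x * norm y" using False by (simp add: norm_scaleC c_def norm_sgn)
    finally show ?thesis .
  qed simp
qed

lemma bounded_linear_cinner_left: "bounded_linear (\<lambda>x. cinner x (y::'a::complex_inner))"
proof (rule bounded_linear_intro[where K="norm y"])
  show "cinner (r *\<^sub>R x) y = r *\<^sub>R cinner x y" for r x
    using cinner_scaleC_left[of "of_real r" x y] by (simp add: scaleC_of_real scaleR_conv_of_real)
qed (auto simp: cinner_add_left norm_cinner_le)

text \<open>Pairing with \<open>\<eta>\<close> carries the derivative \<open>f'\<close> to
  \<open>cinner f' \<eta>\<close>. Vector-valued functions are thus studied through scalar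
  holomorphic ones.\<close>

lemma cinner_analytic:
  assumes "analytic_on_disc f"
  shows "(\<lambda>w. cinner (f w) \<eta>) holomorphic_on unit_disc"
proof (rule holomorphic_onI)
  fix z :: complex assume "z \<in> unit_disc"
  then obtain f' where "(f has_derivative (\<lambda>h. h *\<^sub>C f')) (at z)"
    using assms unfolding analytic_on_disc_def by blast
  from bounded_linear.has_derivative[OF bounded_linear_cinner_left this, of \<eta>]
  have "((\<lambda>w. cinner (f w) \<eta>) has_field_derivative cinner f' \<eta>) (at z)"
    by (simp add: cinner_scaleC_left has_field_derivative_def mult_commute_abs)
  then show "(\<lambda>w. cinner (f w) \<eta>) field_differentiable at z within unit_disc"
    using field_differentiable_at_within field_differentiable_def by blast
qed

section \<open>Geometry of the function space\<close>

context function_inner_space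
begin

lemma ip_add_right: "\<lbrakk>f \<in> H; g \<in> H; h \<in> H\<rbrakk> \<Longrightarrow> ip h (\<lambda>z. f z + g z) = ip h f + ip h g"
  by (subst ip_commute) (simp_all add: add_mem ip_add_left flip: ip_commute)

lemma ip_scale_right: "\<lbrakk>f \<in> H; g \<in> H\<rbrakk> \<Longrightarrow> ip g (\<lambda>z. c *\<^sub>C f z) = cnj c * ip g f"
  by (subst ip_commute) (simp_all add: scale_mem ip_scale_left flip: ip_commute)

lemma ip_diff_left: "\<lbrakk>f \<in> H; g \<in> H; h \<in> H\<rbrakk> \<Longrightarrow> ip (\<lambda>z. f z - g z) h = ip f h - ip g h"
  using ip_add_left[OF _ uminus_mem, of f g h] ip_scale_left[of g h "-1"]
  by (simp add: scaleC_minus_one)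

lemma ip_diff_right: "\<lbrakk>f \<in> H; g \<in> H; h \<in> H\<rbrakk> \<Longrightarrow> ip h (\<lambda>z. f z - g z) = ip h f - ip h g"
  by (subst ip_commute) (simp_all add: diff_mem ip_diff_left flip: ip_commute)

lemma hnorm_nonneg: "f \<in> H \<Longrightarrow> 0 \<le> hnorm ip f"
  using ip_self by (simp add: hnorm_def)

lemma hnorm_zero: "hnorm ip (\<lambda>z. 0) = 0"
  using ip_zero_left[OF zero_mem] by (simp add: hnorm_def)

lemma hnorm_power2: "f \<in> H \<Longrightarrow> (hnorm ip f)\<^sup>2 = Re (ip f f)"
  using ip_self by (simp add: hnorm_def)

lemma ip_self_eq: "f \<in> H \<Longrightarrow> ip f f = of_real ((hnorm ip f)\<^sup>2)"
  using ip_self hnorm_power2 by (simp add: complex_eq_iff del: of_real_power)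

lemma hnorm_eq_0D: "\<lbrakk>f \<in> H; hnorm ip f = 0\<rbrakk> \<Longrightarrow> f = (\<lambda>z. 0)"
  using ip_definite ip_self_eq by simp

lemma hnorm_scale:
  assumes "f \<in> H"
  shows "hnorm ip (\<lambda>z. c *\<^sub>C f z) = cmod c * hnorm ip f"
proof -
  have "ip (\<lambda>z. c *\<^sub>C f z) (\<lambda>z. c *\<^sub>C f z) = (c * cnj c) * ip f f"
    using assms by (simp add: ip_scale_left ip_scale_right scale_mem)
  also have "\<dots> = of_real ((cmod c * hnorm ip f)\<^sup>2)"
    using assms by (simp add: ip_self_eq complex_norm_square[symmetric] power_mult_distrib)
  finally have "Re (ip (\<lambda>z. c *\<^sub>C f z) (\<lambda>z. c *\<^sub>C f z)) = (cmod c * hnorm ip f)\<^sup>2"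
    by (simp del: of_real_power)
  then show ?thesis
    using hnorm_nonneg[OF assms] by (simp add: hnorm_def[of ip "\<lambda>z. c *\<^sub>C f z"])
qed

lemma norm_ip_le:
  assumes "f \<in> H" "g \<in> H"
  shows "cmod (ip f g) \<le> hnorm ip f * hnorm ip g"
proof (cases "ip f g = 0")
  case True
  then show ?thesis using assms by (simp add: hnorm_nonneg)
next
  case False
  define c where "c = cnj (sgn (ip f g))"
  have "c * ip f g = of_real (cmod (ip f g))"
    by (simp add: c_def cnj_sgn_mult_self)
  then have "cmod (ip f g) = Re (ip (\<lambda>z. c *\<^sub>C f z) g)" using assms by (simp add: ip_scale_left)
  also have "\<dots> \<le> hnorm ip (\<lambda>z. c *\<^sub>C f z) * hnorm ip g"
    using assms by (intro Cauchy_Schwarz_Re scale_mem)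
  also have "\<dots> = hnorm ip f * hnorm ip g"
    using False assms by (simp add: hnorm_scale c_def norm_sgn)
  finally show ?thesis .
qed

lemma hdist_eq: "\<lbrakk>f \<in> H; g \<in> H\<rbrakk> \<Longrightarrow> hdist H ip f g = hnorm ip (\<lambda>z. f z - g z)"
  by (simp add: hdist_def)

lemma eq_if_ip_eq:
  assumes "f \<in> H" "g \<in> H" "\<And>h. h \<in> H \<Longrightarrow> ip h f = ip h g"
  shows "f = g"
proof -
  let ?d = "\<lambda>z. f z - g z"
  have "ip ?d ?d = 0"
    using assms by (simp add: ip_diff_right diff_mem)
  then have "?d = (\<lambda>z. 0)" using assms by (intro ip_definite diff_mem)
  then show ?thesis by (auto simp: fun_eq_iff)
qed

text \<open>The choice \<open>f = g\<close> suffices. This bounds elements of which only the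
  pairings are known.\<close>

lemma hnorm_le_if_ip_le:
  assumes "g \<in> H" "0 \<le> B" "\<And>f. f \<in> H \<Longrightarrow> cmod (ip f g) \<le> B * hnorm ip f"
  shows "hnorm ip g \<le> B"
proof (cases "hnorm ip g = 0")
  case False
  then have pos: "hnorm ip g > 0" using hnorm_nonneg[OF assms(1)] by simp
  have "cmod (ip g g) = hnorm ip g * hnorm ip g"
    by (simp only: ip_self_eq[OF assms(1)] norm_of_real) (simp add: power2_eq_square)
  then have "hnorm ip g * hnorm ip g \<le> B * hnorm ip g"
    using assms(3)[OF assms(1)] by simp
  then show ?thesis using pos by simp
qed (use assms in simp)

lemma sum_mem: "(\<And>i. i \<in> A \<Longrightarrow> g i \<in> H) \<Longrightarrow> (\<lambda>z. \<Sum>i\<in>A. g i z) \<in> H"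
  by (induction A rule: infinite_finite_induct) (auto simp: zero_mem add_mem)

lemma ip_sum_left:
  "\<lbrakk>\<And>i. i \<in> A \<Longrightarrow> g i \<in> H; h \<in> H\<rbrakk> \<Longrightarrow> ip (\<lambda>z. \<Sum>i\<in>A. g i z) h = (\<Sum>i\<in>A. ip (g i) h)"
  by (induction A rule: infinite_finite_induct) (auto simp: ip_zero_left ip_add_left sum_mem)

lemma ip_sum_right:
  assumes "\<And>i. i \<in> A \<Longrightarrow> g i \<in> H" "h \<in> H"
  shows "ip h (\<lambda>z. \<Sum>i\<in>A. g i z) = (\<Sum>i\<in>A. ip h (g i))"
proof -
  have "ip h (\<lambda>z. \<Sum>i\<in>A. g i z) = cnj (ip (\<lambda>z. \<Sum>i\<in>A. g i z) h)"
    using assms by (intro ip_commute sum_mem)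
  also have "\<dots> = (\<Sum>i\<in>A. cnj (ip (g i) h))" using assms by (simp add: ip_sum_left)
  also have "\<dots> = (\<Sum>i\<in>A. ip h (g i))"
    using assms by (intro sum.cong refl) (simp flip: ip_commute)
  finally show ?thesis .
qed

lemma hnorm_sum_le:
  "(\<And>i. i \<in> A \<Longrightarrow> g i \<in> H) \<Longrightarrow> hnorm ip (\<lambda>z. \<Sum>i\<in>A. g i z) \<le> (\<Sum>i\<in>A. hnorm ip (g i))"
proof (induction A rule: infinite_finite_induct)
  case (insert x F)
  have "hnorm ip (\<lambda>z. g x z + (\<Sum>i\<in>F. g i z)) \<le> hnorm ip (g x) + hnorm ip (\<lambda>z. \<Sum>i\<in>F. g i z)"
    using insert by (intro hnorm_triangle sum_mem) auto
  then show ?case using insert by force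
qed (auto simp: hnorm_zero)

lemma tendsto_ip_left:
  assumes "limitin mtopology \<sigma> g sequentially" "\<And>n. \<sigma> n \<in> H" "h \<in> H"
  shows "(\<lambda>n. ip (\<sigma> n) h) \<longlonglongrightarrow> ip g h"
proof -
  have g: "g \<in> H" and l: "(\<lambda>n. hdist H ip (\<sigma> n) g) \<longlonglongrightarrow> 0"
    using assms(1) unfolding limitin_metric_dist_null by blast+
  have "(\<lambda>n. hdist H ip (\<sigma> n) g * hnorm ip h) \<longlonglongrightarrow> 0"
    using l by (rule tendsto_mult_left_zero)
  moreover have "\<forall>n. cmod (ip (\<sigma> n) h - ip g h) \<le> hdist H ip (\<sigma> n) g * hnorm ip h"
    using norm_ip_le[OF diff_mem[OF assms(2) g] assms(3)]
    unfolding ip_diff_left[OF assms(2) g assms(3)] hdist_eq[OF assms(2) g] by blast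
  ultimately have "(\<lambda>n. ip (\<sigma> n) h - ip g h) \<longlonglongrightarrow> 0"
    by (elim Lim_null_comparison[OF always_eventually, rotated])
  then show ?thesis by (rule LIM_zero_cancel)
qed

lemma parallelogram:
  assumes "f \<in> H" "g \<in> H"
  shows "(hnorm ip (\<lambda>z. f z - g z))\<^sup>2 + (hnorm ip (\<lambda>z. f z + g z))\<^sup>2
    = 2 * (hnorm ip f)\<^sup>2 + 2 * (hnorm ip g)\<^sup>2"
proof -
  have "ip (\<lambda>z. f z - g z) (\<lambda>z. f z - g z) = ip f f - ip f g - ip g f + ip g g"
    using assms by (simp only: ip_diff_left ip_diff_right diff_mem) simp
  moreover have "ip (\<lambda>z. f z + g z) (\<lambda>z. f z + g z) = ip f f + ip f g + ip g f + ip g g"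
    using assms by (simp only: ip_add_left ip_add_right add_mem) simp
  ultimately show ?thesis
    using assms by (simp only: hnorm_power2 diff_mem add_mem) simp
qed

end

text \<open>The representing vector minimises \<open>\<parallel>f\<parallel>\<^sup>2 - 2 Re (\<phi> f)\<close>; by the parallelogram law every
  minimising sequence is Cauchy.\<close>

lemma (in function_hilbert_space) Riesz_representation:
  assumes add: "\<And>f g. \<lbrakk>f \<in> H; g \<in> H\<rbrakk> \<Longrightarrow> \<phi> (\<lambda>z. f z + g z) = \<phi> f + \<phi> g"
    and scale: "\<And>c f. f \<in> H \<Longrightarrow> \<phi> (\<lambda>z. c *\<^sub>C f z) = c * \<phi> f"
    and bound: "\<And>f. f \<in> H \<Longrightarrow> cmod (\<phi> f) \<le> C * hnorm ip f"
  shows "\<exists>g\<in>H. \<forall>f\<in>H. \<phi> f = ip f g"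
proof -
  define J where "J = (\<lambda>f. (hnorm ip f)\<^sup>2 - 2 * Re (\<phi> f))"
  define m where "m = Inf (J ` H)"
  \<comment> \<open>Completing the square: \<open>J f\<close> is at least
    \<open>(hnorm ip f - C)\<^sup>2 - C\<^sup>2\<close>.\<close>
  have "- (C\<^sup>2) \<le> J f" if "f \<in> H" for f
  proof -
    have "Re (\<phi> f) \<le> C * hnorm ip f"
      using bound[OF that] complex_Re_le_cmod[of "\<phi> f"] by linarith
    moreover have "0 \<le> (hnorm ip f - C)\<^sup>2" by simp
    ultimately show ?thesis by (simp add: J_def power2_diff mult.commute)
  qed
  then have bdd: "bdd_below (J ` H)" by (intro bdd_belowI2)
  have mle: "m \<le> J f" if "f \<in> H" for f
    unfolding m_def using bdd that by (rule cINF_lower)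
  have ne: "J ` H \<noteq> {}" using zero_mem by auto
  have "\<exists>f\<in>H. J f < m + inverse (of_nat (Suc n))" for n
    using cInf_lessD[OF ne, of "m + inverse (of_nat (Suc n))"] by (auto simp: m_def)
  then obtain \<sigma> where sH: "\<And>n. \<sigma> n \<in> H" and sJ: "\<And>n. J (\<sigma> n) < m + inverse (of_nat (Suc n))"
    by metis
  have par: "(hnorm ip (\<lambda>z. f z - g z))\<^sup>2 \<le> 2 * (J f - m) + 2 * (J g - m)"
    if "f \<in> H" "g \<in> H" for f g
  proof -
    \<comment> \<open>At the midpoint, \<open>m \<le> J ?h\<close> bounds the norm of
      \<open>f + g\<close> from below, so the parallelogram law bounds that of \<open>f - g\<close>
      from above.\<close>
    let ?h = "\<lambda>z. (1/2) *\<^sub>C (f z + g z)"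
    have s: "(\<lambda>z. f z + g z) \<in> H" using that by (rule add_mem)
    have "m \<le> J ?h" using s by (intro mle scale_mem)
    also have "J ?h = (hnorm ip (\<lambda>z. f z + g z))\<^sup>2 / 4 - Re (\<phi> f) - Re (\<phi> g)"
      using that s by (simp add: J_def hnorm_scale[OF s] scale[OF s] add power2_eq_square add_divide_distrib)
    finally show ?thesis using parallelogram[OF that] by (simp add: J_def)
  qed
  have "MCauchy \<sigma>"
    unfolding MCauchy_def
  proof (intro conjI allI impI)
    show "range \<sigma> \<subseteq> H" using sH by auto
    fix \<epsilon> :: real assume e: "\<epsilon> > 0"
    then obtain N where N: "inverse (real (Suc N)) < \<epsilon>\<^sup>2 / 4"
      using reals_Archimedean[of "\<epsilon>\<^sup>2 / 4"] by auto
    have small: "J (\<sigma> n) - m < \<epsilon>\<^sup>2 / 4" if "n \<ge> N" for n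
    proof -
      have "inverse (real (Suc n)) \<le> inverse (real (Suc N))" using that by simp
      then show ?thesis using sJ[of n] N by linarith
    qed
    have "hdist H ip (\<sigma> n) (\<sigma> n') < \<epsilon>" if "N \<le> n" "N \<le> n'" for n n'
    proof -
      have "(hdist H ip (\<sigma> n) (\<sigma> n'))\<^sup>2 < \<epsilon>\<^sup>2"
        using par[OF sH sH, of n n'] small[OF that(1)] small[OF that(2)] sH
        by (simp add: hdist_eq)
      then show ?thesis using e by (simp add: power2_less_imp_less)
    qed
    then show "\<exists>N. \<forall>n n'. N \<le> n \<longrightarrow> N \<le> n' \<longrightarrow> hdist H ip (\<sigma> n) (\<sigma> n') < \<epsilon>" by blast
  qed
  then obtain g where lim: "limitin mtopology \<sigma> g sequentially"
    using complete unfolding mcomplete_def by blast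
  then have gH: "g \<in> H" by (simp add: limitin_metric)
  have ReEq: "Re (\<phi> h) = Re (ip g h)" if h: "h \<in> H" for h
  proof -
    \<comment> \<open>First variation at \<open>g\<close>: \<open>J\<close> at
      \<open>\<sigma> n + t h\<close> is at least \<open>m\<close>, and
      \<open>J (\<sigma> n)\<close> exceeds \<open>m\<close> by less than
      \<open>1 / (n + 1)\<close>. The inequality follows in the limit.\<close>
    have tineq: "0 \<le> 2 * t * (Re (ip g h) - Re (\<phi> h)) + t\<^sup>2 * (hnorm ip h)\<^sup>2" for t
    proof (rule LIMSEQ_le)
      show "(\<lambda>n. - inverse (real (Suc n))) \<longlonglongrightarrow> 0"
        using tendsto_minus[OF LIMSEQ_inverse_real_of_nat] by simp
      show "(\<lambda>n. 2 * t * (Re (ip (\<sigma> n) h) - Re (\<phi> h)) + t\<^sup>2 * (hnorm ip h)\<^sup>2)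
          \<longlonglongrightarrow> 2 * t * (Re (ip g h) - Re (\<phi> h)) + t\<^sup>2 * (hnorm ip h)\<^sup>2"
        by (intro tendsto_intros tendsto_Re tendsto_ip_left[OF lim sH h])
      have "- inverse (real (Suc n)) \<le> 2 * t * (Re (ip (\<sigma> n) h) - Re (\<phi> h)) + t\<^sup>2 * (hnorm ip h)\<^sup>2" for n
      proof -
        let ?th = "\<lambda>z. of_real t *\<^sub>C h z"
        have th: "?th \<in> H" using h by (rule scale_mem)
        have "m \<le> J (\<lambda>z. \<sigma> n z + ?th z)" by (intro mle add_mem sH th)
        also have "\<dots> = J (\<sigma> n) + 2 * t * (Re (ip (\<sigma> n) h) - Re (\<phi> h)) + t\<^sup>2 * (hnorm ip h)\<^sup>2"
          using Re_ip_add_self[OF sH[of n] th] Re_ip_scale_self[OF h, of t] sH[of n] h th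
          by (simp add: J_def hnorm_power2 add_mem add scale ip_scale_right distrib_left right_diff_distrib)
        finally show ?thesis using sJ[of n] by linarith
      qed
      then show "\<exists>N. \<forall>n\<ge>N. - inverse (real (Suc n))
          \<le> 2 * t * (Re (ip (\<sigma> n) h) - Re (\<phi> h)) + t\<^sup>2 * (hnorm ip h)\<^sup>2" by blast
    qed
    \<comment> \<open>A quadratic in \<open>t\<close> without constant term that is never negative
      has no linear term. The value \<open>t = - a / (b + 1)\<close> shows this and makes sense for
      \<open>b = 0\<close> too.\<close>
    define a b where "a = Re (ip g h) - Re (\<phi> h)" and "b = (hnorm ip h)\<^sup>2"
    have b: "b \<ge> 0" by (simp add: b_def)
    have "0 \<le> 2 * (- a / (b + 1)) * a + (- a / (b + 1))\<^sup>2 * b"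
      using tineq[of "- a / (b + 1)"] by (simp add: a_def b_def)
    also have "\<dots> = - (a\<^sup>2 * (b + 2) / (b + 1)\<^sup>2)"
      using b by (simp add: power2_eq_square divide_simps) (simp add: algebra_simps)
    finally have "a\<^sup>2 * (b + 2) / (b + 1)\<^sup>2 \<le> 0" by simp
    then have "a\<^sup>2 * (b + 2) \<le> 0" using b by (simp add: divide_le_0_iff)
    then have "a = 0" using b by (simp add: mult_le_0_iff)
    then show ?thesis by (simp add: a_def)
  qed
  have "\<phi> h = ip h g" if h: "h \<in> H" for h
  proof -
    \<comment> \<open>Complex linearity recovers the imaginary part from the real part at
      \<open>\<i> h\<close>.\<close>
    have "Im (\<phi> h) = - Re (\<phi> (\<lambda>z. \<i> *\<^sub>C h z))" using scale[OF h] by simp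
    also have "\<dots> = - Re (ip g (\<lambda>z. \<i> *\<^sub>C h z))" by (simp add: ReEq[OF scale_mem[OF h]])
    also have "\<dots> = - Im (ip g h)" by (simp add: ip_scale_right[OF h gH])
    finally show ?thesis using ReEq[OF h] ip_commute[OF gH h] by (simp add: complex_eq_iff)
  qed
  then show ?thesis using gH by blast
qed

section \<open>Conjugate derivatives and symmetry of the kernel\<close>

text \<open>The conjugations between successive derivatives cancel, so the theory of ordinary higher
  derivatives applies.\<close>

lemma deriv_conj_funpow: "(deriv_conj ^^ n) f w = (deriv ^^ n) (\<lambda>u. f (cnj u)) (cnj w)"
proof (induction n arbitrary: w)
  case (Suc n)
  have "(\<lambda>u. (deriv_conj ^^ n) f (cnj u)) = (deriv ^^ n) (\<lambda>u. f (cnj u))"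
    using Suc by (auto simp: fun_eq_iff)
  then show ?case by (simp add: deriv_conj_def[of "(deriv_conj ^^ n) f"])
qed simp

lemma higher_deriv_cnj_cnj:
  assumes "f holomorphic_on S" "open S" "cnj z \<in> S"
  shows "(deriv ^^ n) (\<lambda>u. cnj (f (cnj u))) z = cnj ((deriv ^^ n) f (cnj z))"
  using assms(3)
proof (induction n arbitrary: z)
  case (Suc n)
  \<comment> \<open>To be differentiated, the induction hypothesis has to hold near
    \<open>z\<close>, not only at \<open>z\<close>.\<close>
  have o: "open (cnj -` S)" using assms(2) by (intro open_vimage) auto
  have "deriv ((deriv ^^ n) (\<lambda>u. cnj (f (cnj u)))) z = deriv (cnj \<circ> (deriv ^^ n) f \<circ> cnj) z"
  proof (rule deriv_cong_ev)
    show "\<forall>\<^sub>F u in nhds z. (deriv ^^ n) (\<lambda>u. cnj (f (cnj u))) u = (cnj \<circ> (deriv ^^ n) f \<circ> cnj) u"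
      by (rule eventually_mono[OF eventually_nhds_in_open[OF o]]) (use Suc in auto)
  qed simp
  also have "\<dots> = cnj (deriv ((deriv ^^ n) f) (cnj z))"
  proof (rule DERIV_imp_deriv)
    have "((deriv ^^ n) f has_field_derivative deriv ((deriv ^^ n) f) (cnj z)) (at (cnj z))"
      using assms Suc by (intro holomorphic_derivI[of _ S] holomorphic_higher_deriv) auto
    then show "(cnj \<circ> (deriv ^^ n) f \<circ> cnj has_field_derivative cnj (deriv ((deriv ^^ n) f) (cnj z))) (at z)"
      using has_field_derivative_cnj_cnj by fastforce
  qed
  finally show ?case by simp
qed simp

text \<open>Polarisation of the quadratic form at the points \<open>z\<close>, \<open>w\<close>,
  whose values are real: the vectors (1,0) and (0,1) make the diagonal real, (1,1) compares
  imaginary parts and (1,i) compares real parts.\<close>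

lemma analytic_kernel_hermitian:
  assumes k: "analytic_kernel k" and z: "z \<in> unit_disc" and w: "w \<in> unit_disc"
  shows "k w z = cnj (k z w)"
proof -
  have pos: "Im (k z z * a * cnj a + k z w * b * cnj a + k w z * a * cnj b + k w w * b * cnj b) = 0" for a b
  proof -
    define p where "p = (\<lambda>i::nat. if i = 0 then z else w)"
    define e where "e = (\<lambda>i::nat. if i = 0 then a else b)"
    have "\<forall>i<2. p i \<in> unit_disc" using z w by (simp add: p_def)
    with k have "(\<Sum>i<2. \<Sum>j<2. cinner (k (p i) (p j) * e j) (e i)) \<in> \<real>\<^sub>\<ge>\<^sub>0"
      unfolding analytic_kernel_def by blast
    then show ?thesis
      by (simp add: numeral_2_eq_2 p_def e_def cinner_complex_def complex_nonneg_Reals_iff add_ac)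
  qed
  have "Im (k z z) = 0" "Im (k w w) = 0" using pos[of 1 0] pos[of 0 1] by auto
  then show ?thesis
    using pos[of 1 1] pos[of 1 "\<i>"] by (simp add: complex_eq_iff)
qed

section \<open>Taylor coefficients and their representing functions\<close>

context analytic_rkhs
begin

lemma holomorphic_cinner: "f \<in> H \<Longrightarrow> (\<lambda>w. cinner (f w) \<eta>) holomorphic_on unit_disc"
  by (intro cinner_analytic analytic)

text \<open>Baire's theorem: the sets \<open>A n\<close> are closed, as evaluations are pairings
  with kernel functions, and they cover \<open>H\<close>, as holomorphic functions are bounded on
  the compact disc. Hence some \<open>A n\<close> contains a ball, and translation and scaling carry
  the bound to all of \<open>H\<close>.\<close>

lemma evaluation_uniformly_bounded:
  assumes "r < 1"
  obtains M where "M \<ge> 0" "\<And>f w. \<lbrakk>f \<in> H; cmod w \<le> r\<rbrakk> \<Longrightarrow> cmod (cinner (f w) \<eta>) \<le> M * hnorm ip f"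
proof -
  define A where "A = (\<lambda>n::nat. {f \<in> H. \<forall>w. cmod w \<le> r \<longrightarrow> cmod (cinner (f w) \<eta>) \<le> real n})"
  have disc: "w \<in> unit_disc" if "cmod w \<le> r" for w using that assms by simp
  have closed: "closedin mtopology (A n)" for n
    unfolding closedin_metric
  proof (intro conjI allI impI)
    show "A n \<subseteq> H" by (auto simp: A_def)
    fix x assume x: "x \<in> H - A n"
    then obtain w where w: "cmod w \<le> r" "cmod (cinner (x w) \<eta>) > real n"
      by (auto simp: A_def not_le)
    define \<kappa> where "\<kappa> = kernel_fun K w \<eta>"
    have \<kappa>: "\<kappa> \<in> H" unfolding \<kappa>_def using disc[OF w(1)] by (rule kernel_mem)
    \<comment> \<open>A perturbation of norm below \<open>\<rho>\<close> changes the value at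
      \<open>w\<close> by less than its excess over \<open>n\<close>. The summand 1 keeps the
      denominator positive.\<close>
    define \<rho> where "\<rho> = (cmod (cinner (x w) \<eta>) - n) / (hnorm ip \<kappa> + 1)"
    have pos: "hnorm ip \<kappa> + 1 > 0" using hnorm_nonneg[OF \<kappa>] by linarith
    have "\<rho> > 0" using w(2) pos by (simp add: \<rho>_def)
    moreover have "y \<notin> mball x \<rho>" if "y \<in> A n" for y
    proof
      assume "y \<in> mball x \<rho>"
      then have y: "y \<in> H" "hnorm ip (\<lambda>z. x z - y z) < \<rho>" using x by (auto simp: hdist_eq)
      have d: "(\<lambda>z. x z - y z) \<in> H" using x y(1) by (intro diff_mem) auto
      have "cinner (x w) \<eta> - cinner (y w) \<eta> = ip (\<lambda>z. x z - y z) \<kappa>"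
        using reproducing[OF d disc[OF w(1)], of \<eta>] by (simp add: \<kappa>_def cinner_diff_left)
      then have "cmod (cinner (x w) \<eta> - cinner (y w) \<eta>) \<le> hnorm ip (\<lambda>z. x z - y z) * hnorm ip \<kappa>"
        using norm_ip_le[OF d \<kappa>] by simp
      also have "\<dots> \<le> hnorm ip (\<lambda>z. x z - y z) * (hnorm ip \<kappa> + 1)"
        using hnorm_nonneg[OF d] by (intro mult_left_mono) auto
      also have "\<dots> < \<rho> * (hnorm ip \<kappa> + 1)" using y(2) pos by (intro mult_strict_right_mono)
      also have "\<dots> = cmod (cinner (x w) \<eta>) - n" using pos by (simp add: \<rho>_def)
      finally have "cmod (cinner (x w) \<eta> - cinner (y w) \<eta>) < cmod (cinner (x w) \<eta>) - n" .
      moreover have "cmod (cinner (y w) \<eta>) \<le> n" using that w(1) by (auto simp: A_def)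
      ultimately show False
        using norm_triangle_ineq2[of "cinner (x w) \<eta>" "cinner (y w) \<eta>"] by linarith
    qed
    ultimately show "\<exists>\<rho>>0. disjnt (A n) (mball x \<rho>)" by (auto simp: disjnt_iff)
  qed
  have "f \<in> (\<Union>n. A n)" if f: "f \<in> H" for f
  proof -
    have "continuous_on (cball 0 r) (\<lambda>w. cinner (f w) \<eta>)"
      by (rule holomorphic_on_imp_continuous_on, rule holomorphic_on_subset[OF holomorphic_cinner[OF f]])
         (use assms in auto)
    then have "bounded ((\<lambda>w. cinner (f w) \<eta>) ` cball 0 r)"
      by (intro compact_imp_bounded compact_continuous_image) auto
    then obtain B where "\<forall>w\<in>cball 0 r. cmod (cinner (f w) \<eta>) \<le> B"
      unfolding bounded_iff by blast
    then have B: "cmod (cinner (f w) \<eta>) \<le> B" if "cmod w \<le> r" for w using that by simp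
    obtain n where "B \<le> real n" using real_arch_simple by blast
    then have "f \<in> A n" using f B by (force simp: A_def)
    then show ?thesis by blast
  qed
  then have UA: "(\<Union>n. A n) = H" by (auto simp: A_def)
  have "\<exists>n. mtopology interior_of (A n) \<noteq> {}"
  proof (rule ccontr)
    assume "\<not> ?thesis"
    then have "mtopology interior_of \<Union>(range A) = {}"
      using complete closed by (intro metric_Baire_category_alt) auto
    moreover have "mtopology interior_of H = H"
      using interior_of_topspace[of mtopology] by simp
    ultimately show False using UA zero_mem by auto
  qed
  then obtain n f0 where "f0 \<in> mtopology interior_of (A n)" by blast
  then obtain U where U: "openin mtopology U" "f0 \<in> U" "U \<subseteq> A n" by (auto simp: interior_of_def)
  then obtain \<rho> where \<rho>: "\<rho> > 0" "mball f0 \<rho> \<subseteq> A n" unfolding openin_mtopology by blast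
  have f0: "f0 \<in> H" "f0 \<in> A n" using U by (auto simp: A_def)
  have "cmod (cinner (g w) \<eta>) \<le> 4 * n / \<rho> * hnorm ip g" if g: "g \<in> H" and w: "cmod w \<le> r" for g w
  proof (cases "hnorm ip g = 0")
    case True
    then have "g = (\<lambda>z. 0)" using hnorm_eq_0D g by blast
    then show ?thesis by (simp add: hnorm_zero)
  next
    case False
    then have gp: "hnorm ip g > 0" using hnorm_nonneg[OF g] by simp
    \<comment> \<open>This scales \<open>g\<close> to norm \<open>\<rho> / 2\<close>, so that
      \<open>f0 + t g\<close> stays in the ball. The values of both \<open>f0\<close> and
      \<open>f0 + t g\<close> are at most \<open>n\<close>, which yields the constant
      \<open>2 * n / t\<close>.\<close>
    define t where "t = \<rho> / (2 * hnorm ip g)"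
    have t: "t > 0" using \<rho> gp by (simp add: t_def)
    let ?tg = "\<lambda>z. of_real t *\<^sub>C g z"
    have tg: "?tg \<in> H" using g by (rule scale_mem)
    have s: "(\<lambda>z. f0 z + ?tg z) \<in> H" using f0(1) tg by (rule add_mem)
    have "hdist H ip (\<lambda>z. f0 z + ?tg z) f0 = t * hnorm ip g"
      using t by (simp add: hdist_eq[OF s f0(1)] hnorm_scale[OF g])
    also have "\<dots> < \<rho>" using gp \<rho> by (simp add: t_def)
    finally have "(\<lambda>z. f0 z + ?tg z) \<in> mball f0 \<rho>" using f0 s by (simp add: commute)
    then have "(\<lambda>z. f0 z + ?tg z) \<in> A n" using \<rho> by blast
    then have "cmod (cinner (f0 w + of_real t *\<^sub>C g w) \<eta>) \<le> n" "cmod (cinner (f0 w) \<eta>) \<le> n"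
      using w f0 by (auto simp: A_def)
    moreover have "of_real t * cinner (g w) \<eta> = cinner (f0 w + of_real t *\<^sub>C g w) \<eta> - cinner (f0 w) \<eta>"
      by (simp add: cinner_add_left cinner_scaleC_left)
    then have "t * cmod (cinner (g w) \<eta>) = cmod (cinner (f0 w + of_real t *\<^sub>C g w) \<eta> - cinner (f0 w) \<eta>)"
      using t by (simp add: norm_mult flip: \<open>of_real t * _ = _\<close>)
    ultimately have "t * cmod (cinner (g w) \<eta>) \<le> 2 * n"
      using norm_triangle_ineq4[of "cinner (f0 w + of_real t *\<^sub>C g w) \<eta>" "cinner (f0 w) \<eta>"] by simp
    then show ?thesis using \<rho> gp by (simp add: t_def field_simps)
  qed
  with \<rho>(1) show ?thesis by (intro that[of "4 * n / \<rho>"]) auto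
qed

text \<open>Pairing with \<open>\<eta>\<close> before differentiating keeps the coefficients scalar,
  so that Cauchy's estimates and power series apply. The result is linear in \<open>f\<close> and
  conjugate-linear in \<open>\<eta>\<close>.\<close>

definition coef :: "'e \<Rightarrow> nat \<Rightarrow> (complex \<Rightarrow> 'e) \<Rightarrow> complex" where
  "coef \<eta> n f = (deriv ^^ n) (\<lambda>w. cinner (f w) \<eta>) 0 / fact n"

lemma coef_add:
  "\<lbrakk>f \<in> H; g \<in> H\<rbrakk> \<Longrightarrow> coef \<eta> n (\<lambda>z. f z + g z) = coef \<eta> n f + coef \<eta> n g"
  unfolding coef_def cinner_add_left
  by (subst higher_deriv_add[OF holomorphic_cinner holomorphic_cinner]) (auto simp: add_divide_distrib)

lemma coef_scale: "f \<in> H \<Longrightarrow> coef \<eta> n (\<lambda>z. c *\<^sub>C f z) = c * coef \<eta> n f"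
  unfolding coef_def cinner_scaleC_left
  by (subst higher_deriv_cmult[OF holomorphic_cinner]) auto

lemma coef_add_vector: "f \<in> H \<Longrightarrow> coef (\<eta> + \<xi>) n f = coef \<eta> n f + coef \<xi> n f"
  unfolding coef_def cinner_add_right
  by (subst higher_deriv_add[OF holomorphic_cinner holomorphic_cinner]) (auto simp: add_divide_distrib)

lemma coef_scale_vector: "f \<in> H \<Longrightarrow> coef (c *\<^sub>C \<eta>) n f = cnj c * coef \<eta> n f"
  unfolding coef_def cinner_scaleC_right
  by (subst higher_deriv_cmult[OF holomorphic_cinner]) auto

text \<open>Cauchy's estimate. Together with the uniform bound on evaluations it makes
  \<open>coef\<close> a bounded functional.\<close>

lemma coef_le:
  assumes M: "\<And>w. cmod w \<le> r \<Longrightarrow> cmod (cinner (f w) \<eta>) \<le> B"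
    and "0 < r" "r < 1" "f \<in> H"
  shows "cmod (coef \<eta> n f) \<le> B / r ^ n"
proof -
  have "cmod ((deriv ^^ n) (\<lambda>w. cinner (f w) \<eta>) 0) \<le> fact n * B / r ^ n"
  proof (rule Cauchy_inequality)
    show "(\<lambda>w. cinner (f w) \<eta>) holomorphic_on ball 0 r"
      by (rule holomorphic_on_subset[OF holomorphic_cinner[OF \<open>f \<in> H\<close>]]) (use assms in auto)
    show "continuous_on (cball 0 r) (\<lambda>w. cinner (f w) \<eta>)"
      by (rule holomorphic_on_imp_continuous_on, rule holomorphic_on_subset[OF holomorphic_cinner[OF \<open>f \<in> H\<close>]])
         (use assms in auto)
  qed (use assms in auto)
  then show ?thesis by (simp add: coef_def norm_divide field_simps)
qed

text \<open>The \<open>D n \<eta>\<close> of the overview; formally \<open>1 / fact n\<close> times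
  the \<open>n\<close>-th conjugate derivative of \<open>kernel_fun K w \<eta>\<close> in
  \<open>w\<close> at 0.\<close>

definition dker :: "nat \<Rightarrow> 'e \<Rightarrow> complex \<Rightarrow> 'e" where
  "dker n \<eta> = (SOME g. g \<in> H \<and> (\<forall>f\<in>H. coef \<eta> n f = ip f g))"

lemma dker: "dker n \<eta> \<in> H" "f \<in> H \<Longrightarrow> ip f (dker n \<eta>) = coef \<eta> n f"
proof -
  obtain M where M: "\<And>f w. \<lbrakk>f \<in> H; cmod w \<le> 1/2\<rbrakk> \<Longrightarrow> cmod (cinner (f w) \<eta>) \<le> M * hnorm ip f"
    using evaluation_uniformly_bounded[of "1/2" \<eta>] by (metis divide_less_eq_1_pos one_less_numeral_iff semiring_norm(76) zero_less_numeral)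
  have "\<exists>g\<in>H. \<forall>f\<in>H. coef \<eta> n f = ip f g"
  proof (rule Riesz_representation)
    show "cmod (coef \<eta> n f) \<le> (M / (1/2) ^ n) * hnorm ip f" if "f \<in> H" for f
      using coef_le[of "1/2" f \<eta> "M * hnorm ip f" n] M that by simp
  qed (auto simp: coef_add coef_scale)
  then have "\<exists>g. g \<in> H \<and> (\<forall>f\<in>H. coef \<eta> n f = ip f g)" by blast
  from someI_ex[OF this, folded dker_def]
  show "dker n \<eta> \<in> H" "f \<in> H \<Longrightarrow> ip f (dker n \<eta>) = coef \<eta> n f" by auto
qed

lemma dker_add: "dker n (\<eta> + \<xi>) = (\<lambda>z. dker n \<eta> z + dker n \<xi> z)"
  by (rule eq_if_ip_eq) (auto simp: dker add_mem ip_add_right coef_add_vector)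

lemma dker_scale: "dker n (c *\<^sub>C \<eta>) = (\<lambda>z. c *\<^sub>C dker n \<eta> z)"
  by (rule eq_if_ip_eq) (auto simp: dker scale_mem ip_scale_right coef_scale_vector)

lemma dker_zero [simp]: "dker n 0 = (\<lambda>z. 0)"
  using dker_scale[of n 0 0] by simp

lemma dker_diff: "dker n (\<eta> - \<xi>) = (\<lambda>z. dker n \<eta> z - dker n \<xi> z)"
  using dker_add[of n \<eta> "-1 *\<^sub>C \<xi>"] dker_scale[of n "-1" \<xi>] by (simp add: scaleC_minus_one)

section \<open>Density of the finite sums\<close>

definition combination :: "nat \<Rightarrow> (nat \<Rightarrow> 'e) \<Rightarrow> complex \<Rightarrow> 'e" where
  "combination N \<eta> = (\<lambda>z. \<Sum>i<N. dker i (\<eta> i) z)"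

lemma combination_mem: "combination N \<eta> \<in> H"
  unfolding combination_def by (intro sum_mem dker)

lemma ip_combination: "f \<in> H \<Longrightarrow> ip f (combination N \<eta>) = (\<Sum>i<N. coef (\<eta> i) i f)"
  unfolding combination_def by (subst ip_sum_right) (auto simp: dker)

text \<open>Padding with zero vectors brings two combinations to a common length, so that they can
  be added termwise.\<close>

lemma combination_pad:
  assumes "N \<le> M"
  shows "combination N \<eta> = combination M (\<lambda>i. if i < N then \<eta> i else 0)"
proof -
  have "(\<Sum>i<M. dker i (if i < N then \<eta> i else 0) z) = (\<Sum>i<N. dker i (\<eta> i) z)" for z
    using assms by (intro sum.mono_neutral_cong_right) auto
  then show ?thesis by (simp add: combination_def)
qed

lemma combination_add: "\<exists>L \<zeta>. (\<lambda>z. combination N \<eta> z + combination M \<xi> z) = combination L \<zeta>"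
proof -
  let ?L = "max N M" and ?e = "\<lambda>i. if i < N then \<eta> i else 0" and ?x = "\<lambda>i. if i < M then \<xi> i else 0"
  have "(\<lambda>z. combination N \<eta> z + combination M \<xi> z) = combination ?L (\<lambda>i. ?e i + ?x i)"
    by (subst combination_pad[of N ?L \<eta>], simp, subst combination_pad[of M ?L \<xi>], simp)
       (simp add: combination_def dker_add sum.distrib)
  then show ?thesis by blast
qed

lemma combination_scale: "(\<lambda>z. c *\<^sub>C combination N \<eta> z) = combination N (\<lambda>i. c *\<^sub>C \<eta> i)"
  by (simp add: combination_def dker_scale scaleC_sum)

text \<open>The coefficients are \<open>cnj w ^ n *\<^sub>C \<eta>\<close>: by duality the error is the remainder in Taylor's theorem,
  which is uniform on the unit ball of \<open>H\<close>.\<close>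

lemma kernel_fun_approx:
  assumes w: "w \<in> unit_disc" and \<epsilon>: "\<epsilon> > 0"
  shows "\<exists>N \<zeta>. hnorm ip (\<lambda>z. kernel_fun K w \<eta> z - combination N \<zeta> z) < \<epsilon>"
proof -
  \<comment> \<open>With \<open>r\<close> strictly between \<open>cmod w\<close> and 1, Cauchy's
    estimate on radius \<open>r\<close> dominates the Taylor series at \<open>w\<close> by a
    geometric series of ratio \<open>q = cmod w / r < 1\<close>.\<close>
  define r where "r = (cmod w + 1) / 2"
  have r: "0 < r" "r < 1" "cmod w < r" using w by (auto simp: r_def add_nonneg_pos)
  obtain M where M0: "M \<ge> 0"
    and M: "\<And>f w. \<lbrakk>f \<in> H; cmod w \<le> r\<rbrakk> \<Longrightarrow> cmod (cinner (f w) \<eta>) \<le> M * hnorm ip f"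
    using evaluation_uniformly_bounded[OF r(2), of \<eta>] by metis
  define q where "q = cmod w / r"
  have q: "0 \<le> q" "q < 1" using r by (auto simp: q_def)
  have "(\<lambda>N. M * (q ^ N / (1 - q))) \<longlonglongrightarrow> 0"
    using tendsto_mult_left[OF LIMSEQ_realpow_zero[OF q], of "M / (1 - q)"] by simp
  then have "\<forall>\<^sub>F N in sequentially. M * (q ^ N / (1 - q)) < \<epsilon>"
    using \<epsilon> by (rule order_tendstoD(2))
  then obtain N where N: "M * (q ^ N / (1 - q)) < \<epsilon>"
    by (meson eventually_sequentially order_refl)
  let ?c = "combination N (\<lambda>i. cnj w ^ i *\<^sub>C \<eta>)"
  let ?d = "\<lambda>z. kernel_fun K w \<eta> z - ?c z"
  have "hnorm ip ?d \<le> M * (q ^ N / (1 - q))"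
  proof (rule hnorm_le_if_ip_le)
    show "?d \<in> H" using w by (intro diff_mem kernel_mem combination_mem)
    show "0 \<le> M * (q ^ N / (1 - q))" using M0 q by simp
    fix f assume f: "f \<in> H"
    have "(\<lambda>n. (deriv ^^ n) (\<lambda>w. cinner (f w) \<eta>) 0 / fact n * (w - 0) ^ n) sums cinner (f w) \<eta>"
      by (rule holomorphic_power_series[OF holomorphic_cinner[OF f] w])
    then have "(\<lambda>n. w ^ n * coef \<eta> n f) sums cinner (f w) \<eta>" by (simp add: coef_def mult.commute)
    then have tail: "(\<lambda>n. w ^ (n + N) * coef \<eta> (n + N) f) sums (cinner (f w) \<eta> - (\<Sum>i<N. w ^ i * coef \<eta> i f))"
      by (subst sums_iff_shift) auto
    have le: "cmod (w ^ (n + N) * coef \<eta> (n + N) f) \<le> q ^ n * (q ^ N * (M * hnorm ip f))" for n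
    proof -
      have "cmod (w ^ (n + N) * coef \<eta> (n + N) f) \<le> cmod w ^ (n + N) * (M * hnorm ip f / r ^ (n + N))"
        unfolding norm_mult norm_power
        by (intro mult_left_mono coef_le[OF M[OF f] r(1,2) f]) auto
      also have "\<dots> = q ^ n * (q ^ N * (M * hnorm ip f))"
        by (simp add: q_def power_divide power_add)
      finally show ?thesis .
    qed
    have geo: "(\<lambda>n. q ^ n * (q ^ N * (M * hnorm ip f))) sums (1 / (1 - q) * (q ^ N * (M * hnorm ip f)))"
      using geometric_sums[of q] q by (intro sums_mult2) auto
    have "ip f ?d = cinner (f w) \<eta> - (\<Sum>i<N. w ^ i * coef \<eta> i f)"
      using f w by (simp add: ip_diff_right kernel_mem combination_mem reproducing ip_combination coef_scale_vector)
    also have "\<dots> = (\<Sum>n. w ^ (n + N) * coef \<eta> (n + N) f)" using tail by (simp add: sums_iff)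
    also have "cmod \<dots> \<le> (\<Sum>n. q ^ n * (q ^ N * (M * hnorm ip f)))"
      using geo le by (intro norm_suminf_le) (auto simp: sums_iff)
    also have "\<dots> = M * (q ^ N / (1 - q)) * hnorm ip f" using geo by (simp add: sums_iff mult_ac)
    finally show "cmod (ip f ?d) \<le> M * (q ^ N / (1 - q)) * hnorm ip f" .
  qed
  then show ?thesis using N by (intro exI[of _ N] exI[of _ "\<lambda>i. cnj w ^ i *\<^sub>C \<eta>"]) simp
qed

text \<open>The functions approximable by combinations form a subspace \<open>P\<close>. It contains
  the kernel functions, hence their span, and totality extends the approximation to all of
  \<open>H\<close>.\<close>

lemma combination_dense:
  assumes f: "f \<in> H" and \<epsilon>: "\<epsilon> > 0"
  shows "\<exists>N \<zeta>. hnorm ip (\<lambda>z. f z - combination N \<zeta> z) < \<epsilon>"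
proof -
  define P where "P = {f \<in> H. \<forall>\<epsilon>>0. \<exists>N \<zeta>. hnorm ip (\<lambda>z. f z - combination N \<zeta> z) < \<epsilon>}"
  have zero: "(\<lambda>z. 0) \<in> P"
  proof -
    have "hnorm ip (\<lambda>z. 0 - combination 0 \<zeta> z) = 0" for \<zeta>
      by (simp add: combination_def hnorm_zero)
    then have "\<exists>N \<zeta>. hnorm ip (\<lambda>z. 0 - combination N \<zeta> z) < \<epsilon>" if "\<epsilon> > 0" for \<epsilon>
      using that by metis
    then show ?thesis unfolding P_def using zero_mem by blast
  qed
  have add: "(\<lambda>z. f z + g z) \<in> P" if P: "f \<in> P" "g \<in> P" for f g
    unfolding P_def
  proof (intro CollectI conjI allI impI)
    show "(\<lambda>z. f z + g z) \<in> H" using that by (auto simp: P_def intro: add_mem)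
    fix \<epsilon> :: real assume "\<epsilon> > 0"
    then have e: "\<epsilon> / 2 > 0" by simp
    obtain N \<zeta> where 1: "hnorm ip (\<lambda>z. f z - combination N \<zeta> z) < \<epsilon> / 2"
      using P(1) e unfolding P_def by blast
    obtain M \<xi> where 2: "hnorm ip (\<lambda>z. g z - combination M \<xi> z) < \<epsilon> / 2"
      using P(2) e unfolding P_def by blast
    obtain L \<theta> where 3: "(\<lambda>z. combination N \<zeta> z + combination M \<xi> z) = combination L \<theta>"
      using combination_add by blast
    have "hnorm ip (\<lambda>z. (f z - combination N \<zeta> z) + (g z - combination M \<xi> z))
        \<le> hnorm ip (\<lambda>z. f z - combination N \<zeta> z) + hnorm ip (\<lambda>z. g z - combination M \<xi> z)"
      using that by (intro hnorm_triangle diff_mem combination_mem) (auto simp: P_def)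
    moreover have "(\<lambda>z. (f z - combination N \<zeta> z) + (g z - combination M \<xi> z))
        = (\<lambda>z. (f z + g z) - combination L \<theta> z)"
      unfolding 3[symmetric] by (simp add: algebra_simps)
    ultimately have "hnorm ip (\<lambda>z. (f z + g z) - combination L \<theta> z) < \<epsilon>" using 1 2 by simp
    then show "\<exists>N \<zeta>. hnorm ip (\<lambda>z. (f z + g z) - combination N \<zeta> z) < \<epsilon>" by blast
  qed
  have scale: "(\<lambda>z. c *\<^sub>C f z) \<in> P" if P: "f \<in> P" for c f
    unfolding P_def
  proof (intro CollectI conjI allI impI)
    have fH: "f \<in> H" using that by (simp add: P_def)
    then show "(\<lambda>z. c *\<^sub>C f z) \<in> H" by (rule scale_mem)
    fix \<epsilon> :: real assume "\<epsilon> > 0"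
    \<comment> \<open>The summand 1 covers \<open>c = 0\<close>.\<close>
    then have "\<epsilon> / (cmod c + 1) > 0" by (simp add: add_nonneg_pos)
    then obtain N \<zeta> where 1: "hnorm ip (\<lambda>z. f z - combination N \<zeta> z) < \<epsilon> / (cmod c + 1)"
      using P unfolding P_def by blast
    let ?d = "\<lambda>z. f z - combination N \<zeta> z"
    have d: "?d \<in> H" using fH by (intro diff_mem combination_mem)
    have "hnorm ip (\<lambda>z. c *\<^sub>C ?d z) = cmod c * hnorm ip ?d" using d by (rule hnorm_scale)
    also have "\<dots> \<le> (cmod c + 1) * hnorm ip ?d" using hnorm_nonneg[OF d] by (intro mult_right_mono) auto
    also have "\<dots> < \<epsilon>"
      using 1 pos_less_divide_eq[of "cmod c + 1"] by (simp add: add_nonneg_pos mult.commute)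
    also have "(\<lambda>z. c *\<^sub>C ?d z) = (\<lambda>z. c *\<^sub>C f z - combination N (\<lambda>i. c *\<^sub>C \<zeta> i) z)"
      by (simp add: scaleC_diff_right flip: combination_scale)
    finally show "\<exists>N \<zeta>. hnorm ip (\<lambda>z. c *\<^sub>C f z - combination N \<zeta> z) < \<epsilon>" by blast
  qed
  have kernel: "kernel_fun K w \<eta> \<in> P" if "w \<in> unit_disc" for w \<eta>
    using that by (simp add: P_def kernel_mem kernel_fun_approx)
  have span: "cspan_fun {kernel_fun K w \<eta> | w \<eta>. w \<in> unit_disc} \<subseteq> P"
  proof
    fix f assume "f \<in> cspan_fun {kernel_fun K w \<eta> | w \<eta>. w \<in> unit_disc}"
    then obtain n c g where f: "f = (\<lambda>z. \<Sum>i<(n::nat). c i *\<^sub>C g i z)"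
      and g: "\<And>i. i < n \<Longrightarrow> g i \<in> {kernel_fun K w \<eta> | w \<eta>. w \<in> unit_disc}"
      unfolding cspan_fun_def by blast
    have gP: "g i \<in> P" if "i < n" for i using g[OF that] kernel by auto
    have "(\<lambda>z. \<Sum>i<m. c i *\<^sub>C g i z) \<in> P" if "m \<le> n" for m
      using that by (induction m) (auto simp: zero intro!: add scale gP)
    then show "f \<in> P" by (simp add: f)
  qed
  have "f \<in> mtopology closure_of cspan_fun {kernel_fun K w \<eta> | w \<eta>. w \<in> unit_disc}"
    using total f by simp
  then have "\<exists>y \<in> cspan_fun {kernel_fun K w \<eta> | w \<eta>. w \<in> unit_disc}. y \<in> mball f (\<epsilon> / 2)"
    unfolding metric_closure_of using half_gt_zero[OF \<epsilon>] by blast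
  then obtain g where g: "g \<in> P" "g \<in> H" "hnorm ip (\<lambda>z. f z - g z) < \<epsilon> / 2"
    using span f by (auto simp: hdist_eq)
  have "\<epsilon> / 2 > 0" using \<epsilon> by simp
  then obtain N \<zeta> where N: "hnorm ip (\<lambda>z. g z - combination N \<zeta> z) < \<epsilon> / 2"
    using g(1) unfolding P_def by blast
  have "hnorm ip (\<lambda>z. (f z - g z) + (g z - combination N \<zeta> z))
      \<le> hnorm ip (\<lambda>z. f z - g z) + hnorm ip (\<lambda>z. g z - combination N \<zeta> z)"
    using f g by (intro hnorm_triangle diff_mem combination_mem)
  then have "hnorm ip (\<lambda>z. f z - combination N \<zeta> z) < \<epsilon>" using N g(3) by simp
  then show ?thesis by blast
qed

end

section \<open>Topological transitivity\<close>

lemma continuous_map_funpow: "continuous_map X X f \<Longrightarrow> continuous_map X X (f ^^ n)"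
  by (induction n) (simp_all add: id_def continuous_map_compose del: o_apply)

text \<open>Birkhoff's theorem: the points whose orbit enters the ball of radius
  \<open>1 / (j + 1)\<close> around \<open>q\<close> form an open set \<open>W (q, j)\<close>, dense
  by transitivity. By Baire's theorem some point lies in all of these countably many sets, and its
  orbit is dense because \<open>Q\<close> is.\<close>

lemma (in Metric_space) transitive_imp_hypercyclic:
  assumes "mcomplete" "M \<noteq> {}" and T: "continuous_map mtopology mtopology T"
    and Q: "countable Q" "Q \<subseteq> M" "mtopology closure_of Q = M"
    and trans: "\<And>U V. \<lbrakk>openin mtopology U; U \<noteq> {}; openin mtopology V; V \<noteq> {}\<rbrakk>
      \<Longrightarrow> \<exists>n. ((T ^^ n) -` U) \<inter> V \<noteq> {}"
  shows "hypercyclic mtopology T"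
proof -
  have Tn: "continuous_map mtopology mtopology (T ^^ n)" for n
    using T by (rule continuous_map_funpow)
  define W where "W = (\<lambda>(q, j::nat). \<Union>n. {x \<in> M. (T ^^ n) x \<in> mball q (inverse (Suc j))})"
  have W: "openin mtopology (W (q, j)) \<and> mtopology closure_of (W (q, j)) = M" if "q \<in> M" for q j
  proof
    let ?B = "mball q (inverse (real (Suc j)))"
    have "q \<in> ?B" using that by simp
    then have B: "openin mtopology ?B" "?B \<noteq> {}" using openin_mball by blast+
    show "openin mtopology (W (q, j))"
      unfolding W_def prod.case
      using openin_continuous_map_preimage[OF Tn B(1)] by (intro openin_Union) auto
    have "W (q, j) \<inter> mball x r \<noteq> {}" if "x \<in> M" "r > 0" for x r
    proof -
      have "mball x r \<noteq> {}" using that by auto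
      then obtain n y where "y \<in> mball x r" "(T ^^ n) y \<in> ?B"
        using trans[OF B openin_mball, of x r] by blast
      then have "y \<in> W (q, j) \<inter> mball x r" by (auto simp: W_def)
      then show ?thesis by blast
    qed
    then show "mtopology closure_of (W (q, j)) = M" unfolding metric_closure_of by blast
  qed
  have "mtopology closure_of \<Inter>(W ` (Q \<times> UNIV)) = M"
    using assms(1) Q W by (intro metric_Baire_category) auto
  moreover obtain x0 where "x0 \<in> M" using \<open>M \<noteq> {}\<close> by blast
  ultimately have "\<exists>y\<in>\<Inter>(W ` (Q \<times> UNIV)). y \<in> mball x0 1"
    unfolding metric_closure_of using zero_less_one by blast
  then have "\<Inter>(W ` (Q \<times> UNIV)) \<inter> M \<noteq> {}" by auto
  then obtain x where x: "x \<in> M" "\<And>q j. q \<in> Q \<Longrightarrow> x \<in> W (q, j)" by blast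
  have TM: "(T ^^ n) x \<in> M" for n
    using continuous_map_image_subset_topspace[OF Tn, of n] x(1) by auto
  have "\<exists>y\<in>{(T ^^ n) x | n. True}. y \<in> mball p r" if p: "p \<in> M" "r > 0" for p r
  proof -
    obtain j where j: "inverse (real (Suc j)) < r / 2" using reals_Archimedean[of "r / 2"] p by auto
    have "r / 2 > 0" using p by simp
    then obtain q where q: "q \<in> Q" "q \<in> mball p (r / 2)"
      using Q(3) p(1) unfolding metric_closure_of by blast
    obtain n where n: "(T ^^ n) x \<in> mball q (inverse (real (Suc j)))"
      using x(2)[OF q(1), of j] by (auto simp: W_def)
    have "d p ((T ^^ n) x) \<le> d p q + d q ((T ^^ n) x)"
      using p q TM Q by (intro triangle) auto
    then have "(T ^^ n) x \<in> mball p r" using q n j p TM by auto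
    then show ?thesis by blast
  qed
  then have "mtopology closure_of {(T ^^ n) x | n. True} = M" unfolding metric_closure_of by blast
  then show ?thesis using x(1) unfolding hypercyclic_def topspace_mtopology by blast
qed

section \<open>The adjoint of multiplication by the coordinate\<close>

locale bounded_mult_z = analytic_rkhs K H ip
  for K :: "complex \<Rightarrow> complex \<Rightarrow> 'e::chilbert_space \<Rightarrow> 'e"
    and H :: "(complex \<Rightarrow> 'e) set" and ip +
  assumes bounded: "bounded_operator H ip mult_z"
begin

lemma mult_z_mem: "f \<in> H \<Longrightarrow> mult_z f \<in> H"
  using bounded unfolding bounded_operator_def by blast

text \<open>The constant is taken to be at least 1 so that its powers increase.\<close>

lemma mult_z_bound:
  obtains C where "C \<ge> 1" "\<And>f. f \<in> H \<Longrightarrow> hnorm ip (mult_z f) \<le> C * hnorm ip f"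
proof -
  obtain C where C: "\<And>f. f \<in> H \<Longrightarrow> hnorm ip (mult_z f) \<le> C * hnorm ip f"
    using bounded unfolding bounded_operator_def by blast
  have "hnorm ip (mult_z f) \<le> max C 1 * hnorm ip f" if "f \<in> H" for f
    using C[OF that] mult_right_mono[OF max.cobounded1 hnorm_nonneg[OF that], of C 1] by linarith
  then show ?thesis by (intro that[of "max C 1"]) auto
qed

abbreviation T :: "(complex \<Rightarrow> 'e) \<Rightarrow> complex \<Rightarrow> 'e" where "T \<equiv> hadjoint H ip mult_z"

text \<open>Riesz representation of \<open>f \<mapsto> ip (mult_z f) g\<close> shows that an adjoint
  exists, so the choice in \<open>hadjoint\<close> has the defining property.\<close>

lemma T_spec: "(\<forall>g\<in>H. T g \<in> H) \<and> (\<forall>f\<in>H. \<forall>g\<in>H. ip (mult_z f) g = ip f (T g))"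
proof -
  obtain C where C: "\<And>f. f \<in> H \<Longrightarrow> hnorm ip (mult_z f) \<le> C * hnorm ip f"
    using mult_z_bound by metis
  have "\<exists>h\<in>H. \<forall>f\<in>H. ip (mult_z f) g = ip f h" if g: "g \<in> H" for g
  proof (rule Riesz_representation)
    show "ip (mult_z (\<lambda>z. f z + f' z)) g = ip (mult_z f) g + ip (mult_z f') g" if "f \<in> H" "f' \<in> H" for f f'
      using bounded that g unfolding bounded_operator_def by (simp add: ip_add_left)
    show "ip (mult_z (\<lambda>z. c *\<^sub>C f z)) g = c * ip (mult_z f) g" if "f \<in> H" for c f
      using bounded that g unfolding bounded_operator_def by (simp add: ip_scale_left)
    show "cmod (ip (mult_z f) g) \<le> (C * hnorm ip g) * hnorm ip f" if "f \<in> H" for f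
      using norm_ip_le[OF mult_z_mem[OF that] g] mult_right_mono[OF C[OF that] hnorm_nonneg[OF g]]
      by (simp add: mult_ac)
  qed
  then obtain S where "\<forall>g\<in>H. S g \<in> H \<and> (\<forall>f\<in>H. ip (mult_z f) g = ip f (S g))" by metis
  then have "\<exists>S. (\<forall>g\<in>H. S g \<in> H) \<and> (\<forall>f\<in>H. \<forall>g\<in>H. ip (mult_z f) g = ip f (S g))" by blast
  from someI_ex[OF this] show ?thesis unfolding hadjoint_def .
qed

lemma T_mem: "g \<in> H \<Longrightarrow> T g \<in> H"
  using T_spec by blast

lemma ip_T: "\<lbrakk>f \<in> H; g \<in> H\<rbrakk> \<Longrightarrow> ip f (T g) = ip (mult_z f) g"
  using T_spec by simp

lemma T_add: "\<lbrakk>f \<in> H; g \<in> H\<rbrakk> \<Longrightarrow> T (\<lambda>z. f z + g z) = (\<lambda>z. T f z + T g z)"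
  by (rule eq_if_ip_eq) (auto simp: T_mem add_mem ip_T ip_add_right mult_z_mem)

lemma T_diff: "\<lbrakk>f \<in> H; g \<in> H\<rbrakk> \<Longrightarrow> T (\<lambda>z. f z - g z) = (\<lambda>z. T f z - T g z)"
  by (rule eq_if_ip_eq) (auto simp: T_mem diff_mem ip_T ip_diff_right mult_z_mem)

lemma T_zero: "T (\<lambda>z. 0) = (\<lambda>z. 0)"
  using T_diff[OF zero_mem zero_mem] by simp

lemma T_bound:
  obtains C where "C \<ge> 1" "\<And>f. f \<in> H \<Longrightarrow> hnorm ip (T f) \<le> C * hnorm ip f"
proof -
  obtain C where C: "C \<ge> 1" "\<And>f. f \<in> H \<Longrightarrow> hnorm ip (mult_z f) \<le> C * hnorm ip f"
    using mult_z_bound by metis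
  have "hnorm ip (T g) \<le> C * hnorm ip g" if g: "g \<in> H" for g
  proof (rule hnorm_le_if_ip_le)
    show "cmod (ip f (T g)) \<le> C * hnorm ip g * hnorm ip f" if "f \<in> H" for f
      using norm_ip_le[OF mult_z_mem[OF that] g] mult_right_mono[OF C(2)[OF that] hnorm_nonneg[OF g]]
      by (simp add: mult_ac ip_T[OF that g])
  qed (use g T_mem C(1) hnorm_nonneg in auto)
  with C(1) show ?thesis by (rule that)
qed

lemma continuous_map_T: "continuous_map mtopology mtopology T"
proof -
  obtain C where C: "C \<ge> 1" "\<And>f. f \<in> H \<Longrightarrow> hnorm ip (T f) \<le> C * hnorm ip f"
    using T_bound by metis
  have "\<exists>\<delta>>0. \<forall>x. x \<in> H \<and> hdist H ip a x < \<delta> \<longrightarrow> hdist H ip (T a) (T x) < \<epsilon>"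
    if a: "a \<in> H" and e: "\<epsilon> > 0" for a \<epsilon>
  proof (intro exI[of _ "\<epsilon> / C"] conjI allI impI)
    show "\<epsilon> / C > 0" using C e by simp
    fix x assume x: "x \<in> H \<and> hdist H ip a x < \<epsilon> / C"
    then have "hdist H ip (T a) (T x) \<le> C * hdist H ip a x"
      using C(2)[OF diff_mem, of a x] a by (simp add: hdist_eq T_mem T_diff)
    also have "\<dots> < \<epsilon>" using x C(1) by (simp add: field_simps)
    finally show "hdist H ip (T a) (T x) < \<epsilon>" .
  qed
  then show ?thesis
    unfolding metric_continuous_map[OF Metric_space_axioms] using T_mem by blast
qed

lemma continuous_map_T_funpow: "continuous_map mtopology mtopology (T ^^ n)"
  using continuous_map_T by (rule continuous_map_funpow)

lemma T_funpow_mem: "g \<in> H \<Longrightarrow> (T ^^ n) g \<in> H"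
  by (induction n) (auto intro: T_mem)

lemma T_funpow_zero: "(T ^^ n) (\<lambda>z. 0) = (\<lambda>z. 0)"
  by (induction n) (auto simp: T_zero)

lemma T_funpow_add: "\<lbrakk>f \<in> H; g \<in> H\<rbrakk> \<Longrightarrow> (T ^^ n) (\<lambda>z. f z + g z) = (\<lambda>z. (T ^^ n) f z + (T ^^ n) g z)"
  by (induction n) (auto simp: T_add T_funpow_mem)

lemma T_funpow_sum:
  "(\<And>i. i \<in> A \<Longrightarrow> g i \<in> H) \<Longrightarrow> (T ^^ n) (\<lambda>z. \<Sum>i\<in>A. g i z) = (\<lambda>z. \<Sum>i\<in>A. (T ^^ n) (g i) z)"
  by (induction A rule: infinite_finite_induct) (auto simp: T_funpow_zero T_funpow_add sum_mem)

lemma T_funpow_bound: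
  assumes "C \<ge> 1" "\<And>f. f \<in> H \<Longrightarrow> hnorm ip (T f) \<le> C * hnorm ip f" "g \<in> H"
  shows "hnorm ip ((T ^^ n) g) \<le> C ^ n * hnorm ip g"
proof (induction n)
  case (Suc n)
  have "hnorm ip (T ((T ^^ n) g)) \<le> C * hnorm ip ((T ^^ n) g)"
    using assms T_funpow_mem by blast
  also have "\<dots> \<le> C * (C ^ n * hnorm ip g)" using Suc assms(1) by (intro mult_left_mono) auto
  finally show ?case by (simp add: mult.assoc)
qed simp

section \<open>The backward shift on the representing functions\<close>

text \<open>In Leibniz's rule at 0 only the first derivative of the identity survives, and its
  factor \<open>Suc n\<close> cancels against the factorials. This forward shift of coefficients is
  dual to the backward shift of \<open>T\<close>.\<close>

lemma coef_mult_z: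
  assumes "f \<in> H"
  shows "coef \<eta> 0 (mult_z f) = 0" "coef \<eta> (Suc n) (mult_z f) = coef \<eta> n f"
proof -
  let ?\<phi> = "\<lambda>w. cinner (f w) \<eta>"
  show "coef \<eta> 0 (mult_z f) = 0" by (simp add: coef_def mult_z_def)
  have "(deriv ^^ Suc n) (\<lambda>w. w * ?\<phi> w) 0
      = (\<Sum>i = 0..Suc n. of_nat (Suc n choose i) * (deriv ^^ i) (\<lambda>w. w) 0 * (deriv ^^ (Suc n - i)) ?\<phi> 0)"
    by (rule higher_deriv_mult[OF _ holomorphic_cinner[OF assms]]) auto
  also have "\<dots> = (\<Sum>i \<in> {1}. of_nat (Suc n choose i) * (deriv ^^ i) (\<lambda>w. w) 0 * (deriv ^^ (Suc n - i)) ?\<phi> 0)"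
    by (rule sum.mono_neutral_right) auto
  also have "\<dots> = of_nat (Suc n) * (deriv ^^ n) ?\<phi> 0" by simp
  finally have "(deriv ^^ Suc n) (\<lambda>w. w * ?\<phi> w) 0 / fact (Suc n) = (deriv ^^ n) ?\<phi> 0 / fact n"
    by (simp add: fact_Suc del: funpow.simps of_nat_Suc)
  then show "coef \<eta> (Suc n) (mult_z f) = coef \<eta> n f"
    by (simp only: coef_def mult_z_def cinner_scaleC_left)
qed

lemma T_dker_0: "T (dker 0 \<eta>) = (\<lambda>z. 0)"
  by (rule eq_if_ip_eq)
     (use ip_commute[OF zero_mem] in \<open>auto simp: T_mem dker zero_mem ip_T mult_z_mem coef_mult_z ip_zero_left\<close>)

lemma T_dker_Suc: "T (dker (Suc n) \<eta>) = dker n \<eta>"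
  by (rule eq_if_ip_eq) (auto simp: T_mem dker ip_T mult_z_mem coef_mult_z)

lemma T_funpow_dker: "(T ^^ j) (dker (n + j) \<eta>) = dker n \<eta>"
  by (induction j) (auto simp: T_dker_Suc funpow_swap1)

text \<open>After \<open>n\<close> steps the index has come down to 0, and the next application
  gives zero.\<close>

lemma T_funpow_dker_less:
  assumes "n < j"
  shows "(T ^^ j) (dker n \<eta>) = (\<lambda>z. 0)"
proof -
  have "(T ^^ j) (dker n \<eta>) = (T ^^ (j - Suc n)) (T ((T ^^ n) (dker n \<eta>)))"
    using assms funpow_add[of "j - Suc n" "Suc n" T] by simp
  also have "(T ^^ n) (dker n \<eta>) = dker 0 \<eta>" using T_funpow_dker[of n 0] by simp
  finally show ?thesis by (simp add: T_dker_0 T_funpow_zero)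
qed

lemma T_funpow_combination:
  assumes "N \<le> j"
  shows "(T ^^ j) (combination N \<eta>) = (\<lambda>z. 0)"
  using assms unfolding combination_def by (subst T_funpow_sum) (auto simp: dker T_funpow_dker_less)

text \<open>The perturbation \<open>\<Sum>i<L. dker (i + j) (\<eta> i)\<close> of a point of \<open>V\<close> is mapped by \<open>T ^^ j\<close> to
  \<open>\<Sum>i<L. dker i (\<eta> i)\<close> in \<open>U\<close>.\<close>

lemma eventually_hits:
  assumes U: "openin mtopology U" "U \<noteq> {}" and V: "openin mtopology V" "V \<noteq> {}"
  obtains L \<eta> \<delta> where "\<delta> > 0"
    "\<And>j. \<lbrakk>j \<ge> L; \<And>i. i < L \<Longrightarrow> hnorm ip (dker (i + j) (\<eta> i)) < \<delta>\<rbrakk> \<Longrightarrow> ((T ^^ j) -` U) \<inter> V \<noteq> {}"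
proof -
  have approx: "\<exists>N \<zeta> \<rho>. \<rho> > 0 \<and> mball (combination N \<zeta>) \<rho> \<subseteq> W" if W: "openin mtopology W" "W \<noteq> {}" for W
  proof -
    obtain f where f: "f \<in> W" using W by blast
    then have fH: "f \<in> H" using W(1) openin_subset by fastforce
    obtain \<rho> where \<rho>: "\<rho> > 0" "mball f \<rho> \<subseteq> W" using W(1) f unfolding openin_mtopology by blast
    have "\<rho> / 2 > 0" using \<rho> by simp
    then obtain N \<zeta> where N: "hnorm ip (\<lambda>z. f z - combination N \<zeta> z) < \<rho> / 2"
      using combination_dense[OF fH] by blast
    have "mball (combination N \<zeta>) (\<rho> / 2) \<subseteq> mball f \<rho>"
      using N fH combination_mem by (intro mball_subset) (auto simp: hdist_eq commute)
    then show ?thesis using \<rho> \<open>\<rho> / 2 > 0\<close> by blast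
  qed
  obtain N \<zeta> \<rho> where 1: "\<rho> > 0" "mball (combination N \<zeta>) \<rho> \<subseteq> U" using approx[OF U] by blast
  obtain M \<xi> \<sigma> where 2: "\<sigma> > 0" "mball (combination M \<xi>) \<sigma> \<subseteq> V" using approx[OF V] by blast
  \<comment> \<open>For \<open>j \<ge> L\<close> the bound \<open>L \<ge> M\<close> makes
    \<open>T ^^ j\<close> annihilate the chosen point of \<open>V\<close>, and
    \<open>L \<ge> N\<close> covers all terms of the perturbation. At most \<open>L\<close> terms
    below \<open>\<delta>\<close> add up to less than \<open>\<sigma>\<close>; the 1 in the
    denominator covers \<open>L = 0\<close>.\<close>
  define L where "L = max N M"
  define \<delta> where "\<delta> = \<sigma> / (L + 1)"
  have "((T ^^ j) -` U) \<inter> V \<noteq> {}" if j: "j \<ge> L"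
    and small: "\<And>i. i < L \<Longrightarrow> hnorm ip (dker (i + j) (\<zeta> i)) < \<delta>" for j
  proof -
    let ?y = "\<lambda>z. \<Sum>i<N. dker (i + j) (\<zeta> i) z"
    let ?x = "\<lambda>z. combination M \<xi> z + ?y z"
    have y: "?y \<in> H" by (intro sum_mem dker)
    have x: "?x \<in> H" using y combination_mem by (rule add_mem[rotated])
    have "(T ^^ j) ?y = combination N \<zeta>"
      unfolding combination_def by (subst T_funpow_sum) (auto simp: dker T_funpow_dker)
    then have Tx: "(T ^^ j) ?x = combination N \<zeta>"
      using j by (simp add: T_funpow_add[OF combination_mem y] T_funpow_combination L_def)
    have "hnorm ip ?y \<le> (\<Sum>i<N. hnorm ip (dker (i + j) (\<zeta> i)))" by (intro hnorm_sum_le dker)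
    also have "\<dots> \<le> (\<Sum>i<N. \<delta>)" by (intro sum_mono less_imp_le small) (auto simp: L_def)
    also have "\<dots> \<le> L * \<delta>" using 2 by (simp add: L_def \<delta>_def divide_right_mono mult_right_mono)
    also have "\<dots> < \<sigma>" using 2 by (simp add: \<delta>_def field_simps)
    finally have "?x \<in> mball (combination M \<xi>) \<sigma>"
      using x combination_mem by (simp add: commute[of _ ?x]) (simp add: hdist_eq)
    then have "?x \<in> V" using 2 by blast
    moreover have "combination N \<zeta> \<in> U" using 1 combination_mem by (meson centre_in_mball_iff subsetD)
    ultimately show ?thesis using Tx by auto
  qed
  moreover have "\<delta> > 0" using 2 by (simp add: \<delta>_def)
  ultimately show ?thesis using that by blast
qed

end

section \<open>Quasi-scalar kernels\<close>

locale quasi_scalar_rkhs = bounded_mult_z "quasi_scalar k" H ip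
  for k and H :: "(complex \<Rightarrow> 'e::chilbert_space) set" and ip +
  assumes kernel: "analytic_kernel k"
begin

text \<open>Formally the coefficient of \<open>z ^ n * cnj w ^ m\<close> in the expansion of
  \<open>k\<close> at the origin.\<close>

definition taylor :: "nat \<Rightarrow> nat \<Rightarrow> complex" where
  "taylor n m = 1 / (fact n * fact m) * mixed_deriv n m k 0 0"

text \<open>By Hermitian symmetry \<open>k w (cnj u)\<close> is the conjugate of
  \<open>k (cnj u) w\<close>, the reflection of a holomorphic function, and reflection conjugates
  the derivatives at 0.\<close>

lemma deriv_conj_kernel:
  assumes "w \<in> unit_disc"
  shows "(deriv_conj ^^ m) (k w) 0 = cnj ((deriv ^^ m) (\<lambda>z. k z w) 0)"
proof -
  have hol: "(\<lambda>z. k z w) holomorphic_on unit_disc"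
    using kernel assms by (simp add: analytic_kernel_def)
  have eq: "cnj (k (cnj u) w) = k w (cnj u)" if "u \<in> unit_disc" for u
    using analytic_kernel_hermitian[OF kernel, of w "cnj u"] that assms by simp
  have "cnj \<circ> (\<lambda>z. k z w) \<circ> cnj holomorphic_on unit_disc"
    by (rule holomorphic_on_compose_cnj_cnj) (use hol in \<open>auto simp: image_cnj_conv_vimage_cnj elim!: holomorphic_on_subset\<close>)
  then have "(\<lambda>u. cnj (k (cnj u) w)) holomorphic_on unit_disc" by (simp add: o_def)
  moreover from this have "(\<lambda>u. k w (cnj u)) holomorphic_on unit_disc"
    using eq by (rule holomorphic_transform)
  ultimately have "(deriv ^^ m) (\<lambda>u. k w (cnj u)) 0 = (deriv ^^ m) (\<lambda>u. cnj (k (cnj u) w)) 0"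
    by (intro higher_deriv_transform_within_open[of _ unit_disc]) (auto simp: eq)
  also have "\<dots> = cnj ((deriv ^^ m) (\<lambda>z. k z w) (cnj 0))"
    by (rule higher_deriv_cnj_cnj[OF hol]) auto
  finally show ?thesis by (simp add: deriv_conj_funpow)
qed

text \<open>The reproducing property makes the left side the conjugate of a Taylor coefficient of
  the kernel function at \<open>w\<close>, thus of \<open>k\<close> in its first variable. Hermitian
  symmetry moves the derivatives to the second.\<close>

lemma cinner_dker:
  assumes w: "w \<in> unit_disc"
  shows "cinner (dker m \<eta> w) \<xi> = (deriv_conj ^^ m) (k w) 0 / fact m * cinner \<eta> \<xi>"
proof -
  let ?K = "kernel_fun (quasi_scalar k) w \<xi>"
  have K: "?K \<in> H" using w by (rule kernel_mem)
  have hol: "(\<lambda>z. k z w) holomorphic_on unit_disc"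
    using kernel w by (simp add: analytic_kernel_def)
  have eq: "cinner (?K z) \<eta> = cinner \<xi> \<eta> * k z w" if "z \<in> unit_disc" for z
    using that by (simp add: kernel_fun_def quasi_scalar_def cinner_scaleC_left)
  have "(deriv ^^ m) (\<lambda>z. cinner (?K z) \<eta>) 0 = (deriv ^^ m) (\<lambda>z. cinner \<xi> \<eta> * k z w) 0"
    using hol by (intro higher_deriv_transform_within_open[OF holomorphic_cinner[OF K]] holomorphic_on_mult)
      (auto simp: eq)
  also have "\<dots> = cinner \<xi> \<eta> * (deriv ^^ m) (\<lambda>z. k z w) 0"
    by (rule higher_deriv_cmult[OF hol]) auto
  finally have "coef \<eta> m ?K = cinner \<xi> \<eta> * (deriv ^^ m) (\<lambda>z. k z w) 0 / fact m"
    by (simp add: coef_def)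
  moreover have "cinner (dker m \<eta> w) \<xi> = cnj (coef \<eta> m ?K)"
    using reproducing[OF dker(1) w, of m \<eta> \<xi>] ip_commute[OF K dker(1), of m \<eta>] dker(2)[OF K] by simp
  ultimately show ?thesis
    using deriv_conj_kernel[OF w] cinner_commute[of \<eta> \<xi>] by simp
qed

text \<open>Pairing with \<open>dker n \<xi>\<close> extracts the \<open>n\<close>-th coefficient of
  \<open>dker m \<eta>\<close>, whose values are given by \<open>cinner_dker\<close>. Hence
  \<open>n\<close> counts derivatives in the first variable and \<open>m\<close> those in the
  second.\<close>

lemma ip_dker_dker: "ip (dker m \<eta>) (dker n \<xi>) = taylor n m * cinner \<eta> \<xi>"
proof -
  let ?G = "\<lambda>w. (deriv_conj ^^ m) (k w) 0"
  let ?c = "cinner \<eta> \<xi> / fact m"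
  have hol: "(\<lambda>w. cinner (dker m \<eta> w) \<xi>) holomorphic_on unit_disc"
    by (rule holomorphic_cinner[OF dker(1)])
  have eq: "cinner (dker m \<eta> w) \<xi> = ?c * ?G w" if "w \<in> unit_disc" for w
    using cinner_dker[OF that] by simp
  have "(deriv ^^ n) (\<lambda>w. cinner (dker m \<eta> w) \<xi>) 0 = ?c * (deriv ^^ n) ?G 0"
  \<comment> \<open>Holomorphy of \<open>?G\<close> is obtained by dividing by
    \<open>cinner \<eta> \<xi>\<close>, so orthogonal vectors are treated apart.\<close>
  proof (cases "cinner \<eta> \<xi> = 0")
    case True
    have "(deriv ^^ n) (\<lambda>w. cinner (dker m \<eta> w) \<xi>) 0 = (deriv ^^ n) (\<lambda>w. 0 :: complex) 0"
      using eq True by (intro higher_deriv_transform_within_open[OF hol]) auto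
    then show ?thesis using True by simp
  next
    case False
    have G: "?G holomorphic_on unit_disc"
    proof (rule holomorphic_transform)
      show "(\<lambda>w. (1 / ?c) * cinner (dker m \<eta> w) \<xi>) holomorphic_on unit_disc"
        by (intro holomorphic_on_mult hol) auto
    qed (use eq False in auto)
    have "(deriv ^^ n) (\<lambda>w. cinner (dker m \<eta> w) \<xi>) 0 = (deriv ^^ n) (\<lambda>w. ?c * ?G w) 0"
      using G eq by (intro higher_deriv_transform_within_open[OF hol] holomorphic_on_mult) auto
    also have "\<dots> = ?c * (deriv ^^ n) ?G 0" by (rule higher_deriv_cmult[OF G]) auto
    finally show ?thesis .
  qed
  then show ?thesis
    by (simp add: dker coef_def taylor_def mixed_deriv_def mult_ac)
qed

lemma hnorm_dker: "hnorm ip (dker n \<eta>) = sqrt (Re (taylor n n)) * norm \<eta>"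
  by (simp add: hnorm_def ip_dker_dker cinner_self real_sqrt_mult flip: of_real_power)

text \<open>One condition on \<open>taylor n n\<close> serves all vectors of norm at most
  \<open>S\<close>.\<close>

lemma hnorm_dker_less:
  assumes "Re (taylor n n) < (\<delta> / S)\<^sup>2" "S > 0" "norm \<eta> \<le> S" "\<delta> > 0"
  shows "hnorm ip (dker n \<eta>) < \<delta>"
proof (cases "\<eta> = 0")
  case False
  have "sqrt (Re (taylor n n)) < \<delta> / S" using assms by (intro real_less_lsqrt) auto
  then have "sqrt (Re (taylor n n)) * norm \<eta> < \<delta> / S * norm \<eta>"
    using False by (intro mult_strict_right_mono) auto
  also have "\<dots> \<le> \<delta> / S * S" using assms by (intro mult_left_mono) auto
  finally show ?thesis using assms by (simp add: hnorm_dker)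
qed (use assms hnorm_zero in simp)

section \<open>Hypercyclicity and mixing\<close>

text \<open>Combinations with vectors from a countable dense set suffice, since
  \<open>dker i\<close> is Lipschitz in its vector. Finite lists encode the tuples of
  vectors.\<close>

lemma countable_dense:
  assumes "separable_space (euclidean :: 'e topology)"
  obtains Q where "countable Q" "Q \<subseteq> H" "mtopology closure_of Q = H"
proof -
  obtain C :: "'e set" where C: "countable C" "closure C = UNIV"
    using assms by (auto simp: separable_space_def)
  define Q where "Q = (\<lambda>\<eta>s. combination (length \<eta>s) (\<lambda>i. \<eta>s ! i)) ` lists C"
  have "countable Q" unfolding Q_def using C by simp
  moreover have Q: "Q \<subseteq> H" by (auto simp: Q_def combination_mem)
  moreover have "\<exists>y\<in>Q. y \<in> mball f \<epsilon>" if f: "f \<in> H" and \<epsilon>: "\<epsilon> > 0" for f \<epsilon>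
  proof -
    obtain N \<zeta> where N: "hnorm ip (\<lambda>z. f z - combination N \<zeta> z) < \<epsilon> / 2"
      using combination_dense[OF f] half_gt_zero[OF \<epsilon>] by blast
    \<comment> \<open>A Lipschitz constant of \<open>dker i\<close>, made strictly positive because
      the tolerance is divided by it.\<close>
    define b where "b = (\<lambda>i. \<bar>sqrt (Re (taylor i i))\<bar> + 1)"
    have b: "b i > 0" "sqrt (Re (taylor i i)) \<le> b i" for i by (auto simp: b_def)
    have "\<exists>\<xi>\<in>C. dist \<xi> (\<zeta> i) < \<epsilon> / (2 * (N + 1)) / b i" for i
      using C(2) b(1)[of i] \<epsilon> closure_approachable[of "\<zeta> i" C] by simp
    then obtain \<xi> where \<xi>: "\<And>i. \<xi> i \<in> C" "\<And>i. dist (\<xi> i) (\<zeta> i) < \<epsilon> / (2 * (N + 1)) / b i" by metis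
    let ?g = "combination N \<xi>"
    have "combination N (\<lambda>i. map \<xi> [0..<N] ! i) = ?g" by (simp add: combination_def)
    then have "?g = combination (length (map \<xi> [0..<N])) (\<lambda>i. map \<xi> [0..<N] ! i)" by simp
    moreover have "map \<xi> [0..<N] \<in> lists C" using \<xi>(1) by auto
    ultimately have gQ: "?g \<in> Q" unfolding Q_def by blast
    have small: "hnorm ip (dker i (\<zeta> i - \<xi> i)) \<le> \<epsilon> / (2 * (N + 1))" for i
    proof -
      have "hnorm ip (dker i (\<zeta> i - \<xi> i)) \<le> b i * norm (\<zeta> i - \<xi> i)"
        unfolding hnorm_dker using b by (intro mult_right_mono) auto
      also have "\<dots> \<le> b i * (\<epsilon> / (2 * (N + 1)) / b i)"
        using b(1)[of i] \<xi>(2)[of i] by (intro mult_left_mono) (auto simp: dist_norm norm_minus_commute)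
      finally show ?thesis using b(1)[of i] by simp
    qed
    have "(\<lambda>z. combination N \<zeta> z - ?g z) = (\<lambda>z. \<Sum>i<N. dker i (\<zeta> i - \<xi> i) z)"
      by (simp add: combination_def dker_diff sum_subtractf)
    then have "hnorm ip (\<lambda>z. combination N \<zeta> z - ?g z) \<le> (\<Sum>i<N. hnorm ip (dker i (\<zeta> i - \<xi> i)))"
      using hnorm_sum_le[of "{..<N}" "\<lambda>i. dker i (\<zeta> i - \<xi> i)"] dker(1) by simp
    also have "\<dots> \<le> (\<Sum>i<N. \<epsilon> / (2 * (N + 1)))" by (intro sum_mono small)
    also have "\<dots> \<le> \<epsilon> / 2" using \<epsilon> by (simp add: field_simps)
    finally have 2: "hnorm ip (\<lambda>z. combination N \<zeta> z - ?g z) \<le> \<epsilon> / 2" .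
    have "hnorm ip (\<lambda>z. (f z - combination N \<zeta> z) + (combination N \<zeta> z - ?g z))
        \<le> hnorm ip (\<lambda>z. f z - combination N \<zeta> z) + hnorm ip (\<lambda>z. combination N \<zeta> z - ?g z)"
      using f by (intro hnorm_triangle diff_mem combination_mem)
    then have "hnorm ip (\<lambda>z. f z - ?g z) < \<epsilon>" using N 2 by simp
    then have "?g \<in> mball f \<epsilon>" using f combination_mem by (simp add: hdist_eq)
    then show ?thesis using gQ by blast
  qed
  then have "mtopology closure_of Q = H" unfolding metric_closure_of by blast
  ultimately show ?thesis using that by blast
qed

text \<open>Boundedness of \<open>T\<close> gives control over \<open>dker n\<close> for all \<open>n\<close> in a window ending at an index
  where \<open>taylor m m\<close> is small.\<close>

lemma hypercyclic_if_frequently_small: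
  assumes sep: "separable_space (euclidean :: 'e topology)"
    and small: "\<And>\<epsilon> M. \<epsilon> > 0 \<Longrightarrow> \<exists>m\<ge>M. Re (taylor m m) < \<epsilon>"
  shows "hypercyclic mtopology T"
proof -
  obtain Q where Q: "countable Q" "Q \<subseteq> H" "mtopology closure_of Q = H"
    using countable_dense[OF sep] by blast
  obtain C where C: "C \<ge> 1" "\<And>f. f \<in> H \<Longrightarrow> hnorm ip (T f) \<le> C * hnorm ip f"
    using T_bound by metis
  show ?thesis
  proof (rule transitive_imp_hypercyclic[OF complete _ continuous_map_T Q])
    show "H \<noteq> {}" using zero_mem by blast
    fix U V assume U: "openin mtopology U" "U \<noteq> {}" and V: "openin mtopology V" "V \<noteq> {}"
    obtain L \<eta> \<delta> where \<delta>: "\<delta> > 0" and hit: "\<And>j. \<lbrakk>j \<ge> L; \<And>i. i < L \<Longrightarrow> hnorm ip (dker (i + j) (\<eta> i)) < \<delta>\<rbrakk>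
        \<Longrightarrow> ((T ^^ j) -` U) \<inter> V \<noteq> {}"
      using eventually_hits[OF U V] by metis
    define S where "S = (\<Sum>i<L. norm (\<eta> i)) + 1"
    have S: "S > 0" "norm (\<eta> i) \<le> S" if "i < L" for i
      using member_le_sum[of i "{..<L}" "\<lambda>i. norm (\<eta> i)"] that
      by (auto simp: S_def add_nonneg_pos sum_nonneg)
    have S0: "S > 0" by (auto simp: S_def add_nonneg_pos sum_nonneg)
    have C0: "C > 0" using C(1) by simp
    then have CL: "C ^ L > 0" by simp
    have "(\<delta> / C ^ L / S)\<^sup>2 > 0" using S0 C0 \<delta> by simp
    \<comment> \<open>The number of steps will be \<open>j = m - L\<close>, and
      \<open>m \<ge> 2 * L\<close> gives \<open>j \<ge> L\<close>. The index \<open>i + j\<close>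
      lies \<open>L - i\<close> below \<open>m\<close>, so descending from \<open>m\<close> to it
      costs a factor of at most \<open>C ^ L\<close>.\<close>
    from small[OF this, of "2 * L"] obtain m
      where m: "m \<ge> 2 * L" "Re (taylor m m) < (\<delta> / C ^ L / S)\<^sup>2" by blast
    have "hnorm ip (dker (i + (m - L)) (\<eta> i)) < \<delta>" if i: "i < L" for i
    proof -
      have "dker (i + (m - L)) (\<eta> i) = (T ^^ (L - i)) (dker m (\<eta> i))"
        using T_funpow_dker[of "L - i" "i + (m - L)" "\<eta> i"] i m(1) by simp
      then have "hnorm ip (dker (i + (m - L)) (\<eta> i)) \<le> C ^ (L - i) * hnorm ip (dker m (\<eta> i))"
        using T_funpow_bound[OF C dker(1)] by simp
      also have "\<dots> \<le> C ^ L * hnorm ip (dker m (\<eta> i))"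
        using C(1) dker(1) hnorm_nonneg by (intro mult_right_mono power_increasing) auto
      also have "\<dots> < C ^ L * (\<delta> / C ^ L)"
        using m(2) S[OF i] CL \<delta> by (intro mult_strict_left_mono hnorm_dker_less[of _ _ S]) auto
      finally show ?thesis using C0 by simp
    qed
    moreover have "L \<le> m - L" using m(1) by linarith
    ultimately have "((T ^^ (m - L)) -` U) \<inter> V \<noteq> {}" by (intro hit)
    then show "\<exists>n. ((T ^^ n) -` U) \<inter> V \<noteq> {}" by blast
  qed
qed

text \<open>For every large \<open>j\<close> all indices \<open>i + j\<close> lie where
  \<open>taylor n n\<close> is small, so \<open>eventually_hits\<close> applies to each such
  \<open>j\<close>, not just to infinitely many.\<close>

lemma topologically_mixing_if_small:
  assumes lim: "(\<lambda>n. taylor n n) \<longlonglongrightarrow> 0"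
  shows "topologically_mixing mtopology T"
  unfolding topologically_mixing_def
proof (intro allI impI)
  fix U V assume *: "openin mtopology U \<and> U \<noteq> {} \<and> openin mtopology V \<and> V \<noteq> {}"
  obtain L \<eta> \<delta> where \<delta>: "\<delta> > 0" and hit: "\<And>j. \<lbrakk>j \<ge> L; \<And>i. i < L \<Longrightarrow> hnorm ip (dker (i + j) (\<eta> i)) < \<delta>\<rbrakk>
      \<Longrightarrow> ((T ^^ j) -` U) \<inter> V \<noteq> {}"
    using eventually_hits[of U V] * by metis
  define S where "S = (\<Sum>i<L. norm (\<eta> i)) + 1"
  have S: "S > 0" by (auto simp: S_def add_nonneg_pos sum_nonneg)
  have le: "norm (\<eta> i) \<le> S" if "i < L" for i
    using member_le_sum[of i "{..<L}" "\<lambda>i. norm (\<eta> i)"] that by (simp add: S_def)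
  have "(\<lambda>n. Re (taylor n n)) \<longlonglongrightarrow> 0" using tendsto_Re[OF lim] by simp
  then have "\<forall>\<^sub>F n in sequentially. Re (taylor n n) < (\<delta> / S)\<^sup>2"
    by (rule order_tendstoD(2)) (use S \<delta> in simp)
  then obtain N where N: "\<And>n. n \<ge> N \<Longrightarrow> Re (taylor n n) < (\<delta> / S)\<^sup>2"
    unfolding eventually_sequentially by blast
  have "((T ^^ j) -` U) \<inter> V \<noteq> {}" if "j \<ge> max L N" for j
    using that S le \<delta> by (intro hit hnorm_dker_less[of _ _ S] N) auto
  then show "\<exists>N. \<forall>j\<ge>N. ((T ^^ j) -` U) \<inter> V \<noteq> {}" by blast
qed

section \<open>Periodic points and chaos\<close>

lemma hnorm_sum_dker:
  "(hnorm ip (\<lambda>z. \<Sum>n\<in>F. dker n \<eta> z))\<^sup>2 = Re (\<Sum>n\<in>F. \<Sum>m\<in>F. taylor n m) * (norm \<eta>)\<^sup>2"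
proof -
  let ?s = "\<lambda>z. \<Sum>n\<in>F. dker n \<eta> z"
  have s: "?s \<in> H" by (intro sum_mem dker)
  have "ip ?s ?s = (\<Sum>m\<in>F. \<Sum>n\<in>F. taylor n m * of_real ((norm \<eta>)\<^sup>2))"
    using s by (simp add: ip_sum_left ip_sum_right dker(1) ip_dker_dker cinner_self)
  also have "\<dots> = (\<Sum>n\<in>F. \<Sum>m\<in>F. taylor n m) * of_real ((norm \<eta>)\<^sup>2)"
    by (subst sum.swap) (simp add: sum_distrib_right)
  finally show ?thesis by (simp add: hnorm_power2[OF s] flip: of_real_power)
qed

text \<open>The square partial sums in \<open>F_summable\<close> are, up to the factor
  \<open>(norm \<eta>)\<^sup>2\<close>, squared norms of finite sums of
  \<open>dker n \<eta>\<close>. They control arbitrary finite index sets, and in particular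
  arithmetic progressions.\<close>

lemma small_tails:
  assumes F: "F_summable taylor" and \<epsilon>: "\<epsilon> > 0"
  obtains N where "\<And>F. \<lbrakk>finite F; F \<subseteq> {N..}\<rbrakk> \<Longrightarrow> hnorm ip (\<lambda>z. \<Sum>n\<in>F. dker n \<eta> z) < \<epsilon>"
proof -
  define c where "c = (\<epsilon> / (norm \<eta> + 1))\<^sup>2"
  have n1: "norm \<eta> + 1 > 0" by (simp add: add_nonneg_pos)
  then have "c > 0" using \<epsilon> by (simp add: c_def)
  then obtain N where N: "\<And>F. finite F \<and> F \<subseteq> {N..} \<Longrightarrow> cmod (\<Sum>n\<in>F. \<Sum>m\<in>F. taylor n m) < c"
    using F unfolding F_summable_def by metis
  have "hnorm ip (\<lambda>z. \<Sum>n\<in>F. dker n \<eta> z) < \<epsilon>" if "finite F" "F \<subseteq> {N..}" for F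
  proof -
    have "(hnorm ip (\<lambda>z. \<Sum>n\<in>F. dker n \<eta> z))\<^sup>2 \<le> c * (norm \<eta>)\<^sup>2"
      unfolding hnorm_sum_dker using N[of F] that complex_Re_le_cmod[of "\<Sum>n\<in>F. \<Sum>m\<in>F. taylor n m"]
      by (intro mult_right_mono) auto
    also have "\<dots> < c * (norm \<eta> + 1)\<^sup>2"
      using \<open>c > 0\<close> by (intro mult_strict_left_mono power_strict_mono) auto
    also have "\<dots> = \<epsilon>\<^sup>2" using n1 by (simp add: c_def power_divide)
    finally show ?thesis using \<epsilon> by (simp add: power2_less_imp_less)
  qed
  then show ?thesis using that by blast
qed

text \<open>The periodic point is \<open>\<Sum>l. dker (i + l * p) \<eta>\<close>.\<close>

lemma periodic_near_dker:
  assumes F: "F_summable taylor" and \<epsilon>: "\<epsilon> > 0"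
  shows "\<exists>P. \<forall>p\<ge>P. \<exists>g\<in>H. (T ^^ p) g = g \<and> hnorm ip (\<lambda>z. g z - dker i \<eta> z) < \<epsilon>"
proof -
  obtain N where N: "\<And>F. \<lbrakk>finite F; F \<subseteq> {N..}\<rbrakk> \<Longrightarrow> hnorm ip (\<lambda>z. \<Sum>n\<in>F. dker n \<eta> z) < \<epsilon> / 2"
    using small_tails[OF F half_gt_zero[OF \<epsilon>], of \<eta>] by metis
  \<comment> \<open>From \<open>p \<ge> N\<close> all terms with \<open>l \<ge> 1\<close> lie in the
    small tail. From \<open>p > i\<close> the power \<open>T ^^ p\<close> annihilates
    \<open>dker i \<eta>\<close>, and the indices \<open>i + l * p\<close> are distinct.\<close>
  have "\<exists>g\<in>H. (T ^^ p) g = g \<and> hnorm ip (\<lambda>z. g z - dker i \<eta> z) < \<epsilon>" if p: "p \<ge> max N (Suc i)" for p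
  proof -
    define s where "s = (\<lambda>J z. \<Sum>l<J. dker (i + l * p) \<eta> z)"
    have s: "s J \<in> H" for J unfolding s_def by (intro sum_mem dker)
    have le: "l \<le> i + l * p" for l using p by (cases p) auto
    have diff: "s J' z - s J z = (\<Sum>n\<in>(\<lambda>l. i + l * p) ` {J..<J'}. dker n \<eta> z)" if "J \<le> J'" for J J' z
    proof -
      have inj: "inj_on (\<lambda>l. i + l * p) {J..<J'}" using p by (auto simp: inj_on_def)
      have "{..<J'} = {..<J} \<union> {J..<J'}" using that by auto
      then have "s J' z = s J z + (\<Sum>l\<in>{J..<J'}. dker (i + l * p) \<eta> z)"
        unfolding s_def by (simp add: sum.union_disjoint ivl_disj_int)
      then show ?thesis by (simp add: sum.reindex[OF inj])
    qed
    have "MCauchy s"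
      unfolding MCauchy_def
    proof (intro conjI allI impI)
      show "range s \<subseteq> H" using s by blast
      fix e :: real assume "e > 0"
      from small_tails[OF F this, of \<eta>] obtain M
        where M: "\<And>F. \<lbrakk>finite F; F \<subseteq> {M..}\<rbrakk> \<Longrightarrow> hnorm ip (\<lambda>z. \<Sum>n\<in>F. dker n \<eta> z) < e"
        by metis
      have *: "hdist H ip (s J) (s J') < e" if "M \<le> J" "J \<le> J'" for J J'
      proof -
        have "hnorm ip (\<lambda>z. s J' z - s J z) < e"
          unfolding diff[OF that(2)]
        proof (rule M)
          show "(\<lambda>l. i + l * p) ` {J..<J'} \<subseteq> {M..}" using that le by (force intro: order_trans[OF _ le])
        qed simp
        then show ?thesis by (simp add: commute[of "s J"] hdist_eq s)
      qed
      show "\<exists>M. \<forall>J J'. M \<le> J \<longrightarrow> M \<le> J' \<longrightarrow> hdist H ip (s J) (s J') < e"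
      proof (intro exI allI impI)
        fix J J' assume "M \<le> J" "M \<le> J'"
        then show "hdist H ip (s J) (s J') < e"
          using *[of J J'] *[of J' J] commute[of "s J" "s J'"] by (cases "J \<le> J'") auto
      qed
    qed
    then obtain g where lim: "limitin mtopology s g sequentially"
      using complete unfolding mcomplete_def by blast
    then have g: "g \<in> H" by (simp add: limitin_metric)
    \<comment> \<open>\<open>T ^^ p\<close> removes the first term and moves each later one into the
      place of its predecessor. In the limit this becomes \<open>(T ^^ p) g = g\<close>.\<close>
    have Ts: "(T ^^ p) (s (Suc J)) = s J" for J
    proof -
      have "(T ^^ p) (s (Suc J)) = (\<lambda>z. \<Sum>l<Suc J. (T ^^ p) (dker (i + l * p) \<eta>) z)"
        unfolding s_def by (rule T_funpow_sum) (rule dker)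
      also have "\<dots> = (\<lambda>z. (T ^^ p) (dker i \<eta>) z + (\<Sum>l<J. (T ^^ p) (dker (i + Suc l * p) \<eta>) z))"
        by (subst sum.lessThan_Suc_shift) simp
      also have "\<dots> = s J"
      proof -
        have "(T ^^ p) (dker (i + Suc l * p) \<eta>) = dker (i + l * p) \<eta>" for l
          using T_funpow_dker[of p "i + l * p" \<eta>] by (simp add: algebra_simps)
        moreover have "(T ^^ p) (dker i \<eta>) = (\<lambda>z. 0)" using p by (intro T_funpow_dker_less) auto
        ultimately show ?thesis by (simp add: s_def)
      qed
      finally show ?thesis .
    qed
    have "limitin mtopology (s \<circ> Suc) g sequentially"
      using lim by (rule limitin_subsequence[rotated]) (simp add: strict_mono_Suc_iff)
    from continuous_map_limit[OF continuous_map_T_funpow[of p] this]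
    have "limitin mtopology s ((T ^^ p) g) sequentially" by (simp add: o_def Ts)
    then have per: "(T ^^ p) g = g" using lim limitin_metric_unique by (metis trivial_limit_sequentially)
    \<comment> \<open>\<open>J \<ge> 1\<close> ensures that \<open>s J\<close> contains the term
      \<open>s 1 = dker i \<eta>\<close>, so that \<open>s J - s 1\<close> is part of the
      tail.\<close>
    obtain J where J: "J \<ge> 1" "hdist H ip (s J) g < \<epsilon> / 2"
    proof -
      obtain J0 where "\<And>J. J \<ge> J0 \<Longrightarrow> hdist H ip (s J) g < \<epsilon> / 2"
        using lim half_gt_zero[OF \<epsilon>] unfolding limitin_metric eventually_sequentially by blast
      then show ?thesis using that[of "max J0 1"] by simp
    qed
    have s1: "s 1 = dker i \<eta>" by (simp add: s_def)
    have "hnorm ip (\<lambda>z. s J z - s 1 z) < \<epsilon> / 2"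
      unfolding diff[OF J(1)]
    proof (rule N)
      have "p \<le> i + l * p" if "l \<ge> 1" for l using mult_le_mono1[OF that, of p] by linarith
      then show "(\<lambda>l. i + l * p) ` {1..<J} \<subseteq> {N..}" using p by (force intro: order_trans)
    qed simp
    then have "hdist H ip (s J) (dker i \<eta>) < \<epsilon> / 2" by (simp only: hdist_eq s dker(1) s1)
    then have "hdist H ip g (dker i \<eta>) < \<epsilon>"
      using J(2) triangle[OF g s dker(1), of i \<eta> J] by (simp add: commute)
    then show ?thesis using g per by (auto simp: hdist_eq dker(1))
  qed
  then show ?thesis by blast
qed

text \<open>Fixed points of the same power \<open>T ^^ p\<close> can be added. Approximation for all
  large \<open>p\<close> lets the finitely many summands share one \<open>p\<close>.\<close>

lemma periodic_near_combination:
  assumes F: "F_summable taylor" and \<epsilon>: "\<epsilon> > 0"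
  shows "\<exists>P. \<forall>p\<ge>P. \<exists>g\<in>H. (T ^^ p) g = g \<and> hnorm ip (\<lambda>z. g z - combination N \<zeta> z) < \<epsilon>"
  using \<epsilon>
proof (induction N arbitrary: \<epsilon>)
  case 0
  then show ?case
    by (intro exI[of _ 0] allI impI bexI[OF _ zero_mem]) (simp add: combination_def T_funpow_zero hnorm_zero)
next
  case (Suc N)
  obtain P where P: "\<And>p. p \<ge> P \<Longrightarrow> \<exists>g\<in>H. (T ^^ p) g = g \<and> hnorm ip (\<lambda>z. g z - combination N \<zeta> z) < \<epsilon> / 2"
    using Suc.IH[OF half_gt_zero[OF Suc.prems]] by blast
  obtain P' where P': "\<And>p. p \<ge> P' \<Longrightarrow> \<exists>g\<in>H. (T ^^ p) g = g \<and> hnorm ip (\<lambda>z. g z - dker N (\<zeta> N) z) < \<epsilon> / 2"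
    using periodic_near_dker[OF F half_gt_zero[OF Suc.prems]] by blast
  have "\<exists>g\<in>H. (T ^^ p) g = g \<and> hnorm ip (\<lambda>z. g z - combination (Suc N) \<zeta> z) < \<epsilon>" if p: "p \<ge> max P P'" for p
  proof -
    obtain g where g: "g \<in> H" "(T ^^ p) g = g" "hnorm ip (\<lambda>z. g z - combination N \<zeta> z) < \<epsilon> / 2"
      using P[of p] p by auto
    obtain g' where g': "g' \<in> H" "(T ^^ p) g' = g'" "hnorm ip (\<lambda>z. g' z - dker N (\<zeta> N) z) < \<epsilon> / 2"
      using P'[of p] p by auto
    have "hnorm ip (\<lambda>z. (g z - combination N \<zeta> z) + (g' z - dker N (\<zeta> N) z))
        \<le> hnorm ip (\<lambda>z. g z - combination N \<zeta> z) + hnorm ip (\<lambda>z. g' z - dker N (\<zeta> N) z)"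
      using g g' by (intro hnorm_triangle diff_mem combination_mem dker)
    moreover have "(\<lambda>z. (g z - combination N \<zeta> z) + (g' z - dker N (\<zeta> N) z))
        = (\<lambda>z. (g z + g' z) - combination (Suc N) \<zeta> z)"
      by (simp add: combination_def algebra_simps)
    ultimately have "hnorm ip (\<lambda>z. (g z + g' z) - combination (Suc N) \<zeta> z) < \<epsilon>"
      using g(3) g'(3) by simp
    then show ?thesis
      using g g' by (intro bexI[of _ "\<lambda>z. g z + g' z"]) (auto simp: T_funpow_add add_mem)
  qed
  then show ?case by blast
qed

text \<open>Singleton index sets in \<open>F_summable\<close> make the diagonal
  \<open>taylor m m\<close> small, which gives hypercyclicity. Periodic points approximate the
  combinations, which are dense.\<close>

lemma chaotic_if_F_summable:
  assumes sep: "separable_space (euclidean :: 'e topology)" and F: "F_summable taylor"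
  shows "chaotic mtopology T"
  unfolding chaotic_def
proof
  have "\<exists>m\<ge>M. Re (taylor m m) < \<epsilon>" if \<epsilon>: "\<epsilon> > 0" for \<epsilon> M
  proof -
    obtain N where N: "\<And>F. finite F \<and> F \<subseteq> {N..} \<Longrightarrow> cmod (\<Sum>n\<in>F. \<Sum>m\<in>F. taylor n m) < \<epsilon>"
      using F \<epsilon> unfolding F_summable_def by metis
    have "Re (taylor (max M N) (max M N)) < \<epsilon>"
      using N[of "{max M N}"] complex_Re_le_cmod[of "taylor (max M N) (max M N)"] by simp
    then show ?thesis using max.cobounded1 by blast
  qed
  then show "hypercyclic mtopology T" using sep by (intro hypercyclic_if_frequently_small)
  have "\<exists>y\<in>{y \<in> H. \<exists>k\<ge>1. (T ^^ k) y = y}. y \<in> mball f \<epsilon>" if f: "f \<in> H" and \<epsilon>: "\<epsilon> > 0" for f \<epsilon>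
  proof -
    obtain N \<zeta> where N: "hnorm ip (\<lambda>z. f z - combination N \<zeta> z) < \<epsilon> / 2"
      using combination_dense[OF f half_gt_zero[OF \<epsilon>]] by blast
    obtain P where P: "\<And>p. p \<ge> P \<Longrightarrow> \<exists>g\<in>H. (T ^^ p) g = g \<and> hnorm ip (\<lambda>z. g z - combination N \<zeta> z) < \<epsilon> / 2"
      using periodic_near_combination[OF F half_gt_zero[OF \<epsilon>]] by blast
    \<comment> \<open>The maximum with 1 excludes the exponent 0, which would not witness
      periodicity.\<close>
    obtain g where g: "g \<in> H" "(T ^^ max P 1) g = g" "hnorm ip (\<lambda>z. g z - combination N \<zeta> z) < \<epsilon> / 2"
      using P[of "max P 1"] by auto
    have "hdist H ip f g < \<epsilon>"
      using triangle[OF f combination_mem g(1), of N \<zeta>] N g f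
      by (simp add: commute[of "combination N \<zeta>"]) (simp add: hdist_eq combination_mem)
    then have "g \<in> mball f \<epsilon>" using f g by simp
    then show ?thesis using g max.cobounded2 by blast
  qed
  then show "mtopology closure_of {y \<in> topspace mtopology. \<exists>k\<ge>1. (T ^^ k) y = y} = topspace mtopology"
    unfolding metric_closure_of topspace_mtopology by blast
qed

end

theorem theorem5p1:
  fixes k :: "complex \<Rightarrow> complex \<Rightarrow> complex"
    and H :: "(complex \<Rightarrow> 'e::chilbert_space) set"
    and ip :: "(complex \<Rightarrow> 'e) \<Rightarrow> (complex \<Rightarrow> 'e) \<Rightarrow> complex"
  assumes "separable_space (euclidean :: 'e topology)"
    and "analytic_kernel k"
    and "analytic_rkhs (quasi_scalar k) H ip"
    and "bounded_operator H ip mult_z"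
  shows "(liminf (\<lambda>n. ereal (Re (1 / (fact n)\<^sup>2 * mixed_deriv n n k 0 0))) = 0
            \<longrightarrow> hypercyclic (htopology H ip) (hadjoint H ip mult_z))
       \<and> ((\<lambda>n. 1 / (fact n)\<^sup>2 * mixed_deriv n n k 0 0) \<longlonglongrightarrow> 0
            \<longrightarrow> topologically_mixing (htopology H ip) (hadjoint H ip mult_z))
       \<and> (F_summable (\<lambda>n m. 1 / (fact n * fact m) * mixed_deriv n m k 0 0)
            \<longrightarrow> chaotic (htopology H ip) (hadjoint H ip mult_z))"
proof -
  interpret analytic_rkhs "quasi_scalar k" H ip by fact
  interpret quasi_scalar_rkhs k H ip by unfold_locales fact+
  have diag: "1 / (fact n)\<^sup>2 * mixed_deriv n n k 0 0 = taylor n n" for n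
    by (simp add: taylor_def power2_eq_square)
  \<comment> \<open>Otherwise \<open>\<epsilon>\<close> would be an eventual lower bound and hence a
    lower bound of the limit inferior.\<close>
  have "\<exists>m\<ge>M. Re (taylor m m) < \<epsilon>"
    if lim: "liminf (\<lambda>n. ereal (Re (taylor n n))) = 0" and \<epsilon>: "\<epsilon> > 0" for \<epsilon> M
  proof (rule ccontr)
    assume "\<not> ?thesis"
    then have "\<forall>\<^sub>F n in sequentially. ereal \<epsilon> \<le> ereal (Re (taylor n n))"
      by (auto simp: eventually_sequentially not_less)
    then have "ereal \<epsilon> \<le> liminf (\<lambda>n. ereal (Re (taylor n n)))" by (rule Liminf_bounded)
    then show False using lim \<epsilon> by simp
  qed
  then have "liminf (\<lambda>n. ereal (Re (taylor n n))) = 0 \<longrightarrow> hypercyclic mtopology T"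
    using assms(1) by (auto intro: hypercyclic_if_frequently_small)
  moreover have "F_summable (\<lambda>n m. 1 / (fact n * fact m) * mixed_deriv n m k 0 0) \<longrightarrow> chaotic mtopology T"
    using chaotic_if_F_summable[OF assms(1)] unfolding taylor_def[abs_def] by blast
  ultimately show ?thesis
    unfolding diag using topologically_mixing_if_small by blast
qed

end
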